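(* Let $p(\boldsymbol z)=a_{10}z_1+a_{01}z_2+a_{20}z_1^2+a_{11}z_1z_2+a_{02}z_2^2$ be a complex polynomial, and put $p_0=0$, $p_1(z)=a_{10}+a_{01}z$, $p_2(z)=a_{20}+a_{11}z+a_{02}z^2$. There exists a holomorphic function $q$ on the bidisc $\mathbb D^2$ with $q^{(I)}(\boldsymbol 0)=0$ for $|I|=0,1,2$ such that $\sup_{\mathbb D^2}|p+q|\le 1$ if and only if $|p_2(z)|\le 1-|p_1(z)|^2$ for all $z\in\mathbb D$ and there exist one-variable complex polynomials $p_k$, $k\ge 3$, with $\deg p_k\le k$, and a holomorphic function $f:\mathbb D\to\mathcal B(L^2(\mathbb T))$ such that \[\frac{f^{(k)}(0)}{k!}=M_{p_k}\ \text{ for all } k\ge 0,\qquad \sup_{z\in\mathbb D}\|f(z)\|\le 1 .\]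
   Context: $\mathbb D$ is the open unit disc, $\mathbb T$ the unit circle. For $\phi\in L^\infty(\mathbb T)$, $M_\phi$ is the multiplication operator $g\mapsto\phi g$ on $L^2(\mathbb T)$. For a multi-index $I=(i_1,i_2)$, $q^{(I)}=\partial_1^{i_1}\partial_2^{i_2}q$ and $|I|=i_1+i_2$. *)

theory Defs
  imports
    "HOL-Complex_Analysis.Complex_Analysis"
    "HOL-Computational_Algebra.Polynomial"
begin

definition bidisc :: "(complex \<times> complex) set" where
  "bidisc = ball 0 1 \<times> ball 0 1"

text \<open>Holomorphy in two variables: the real Frechet derivative at each point exists and is complex linear.\<close>

definition holomorphic2_on :: "(complex \<times> complex \<Rightarrow> complex) \<Rightarrow> (complex \<times> complex) set \<Rightarrow> bool"
    (infixl "holomorphic2'_on" 50) where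
  "q holomorphic2_on S \<longleftrightarrow>
     (\<forall>z\<in>S. \<exists>a b. (q has_derivative (\<lambda>h. a * fst h + b * snd h)) (at z within S))"

definition pderiv1 :: "(complex \<times> complex \<Rightarrow> complex) \<Rightarrow> complex \<times> complex \<Rightarrow> complex" where
  "pderiv1 q = (\<lambda>z. deriv (\<lambda>w. q (w, snd z)) (fst z))"

definition pderiv2 :: "(complex \<times> complex \<Rightarrow> complex) \<Rightarrow> complex \<times> complex \<Rightarrow> complex" where
  "pderiv2 q = (\<lambda>z. deriv (\<lambda>w. q (fst z, w)) (snd z))"

definition mixed_deriv :: "nat \<times> nat \<Rightarrow> (complex \<times> complex \<Rightarrow> complex) \<Rightarrow> complex \<times> complex \<Rightarrow> complex" where
  "mixed_deriv I q = (pderiv1 ^^ fst I) ((pderiv2 ^^ snd I) q)"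

text \<open>Normalised arc length on the unit circle.\<close>

definition circle_measure :: "complex measure" where
  "circle_measure =
     distr (uniform_measure lborel {0..<2 * pi}) (restrict_space borel (sphere 0 1)) cis"

definition square_integrable :: "(complex \<Rightarrow> complex) \<Rightarrow> bool" where
  "square_integrable f \<longleftrightarrow>
     f \<in> borel_measurable circle_measure \<and> integrable circle_measure (\<lambda>x. (cmod (f x))\<^sup>2)"

definition essentially_bounded :: "(complex \<Rightarrow> complex) \<Rightarrow> bool" where
  "essentially_bounded f \<longleftrightarrow>
     f \<in> borel_measurable circle_measure \<and> (\<exists>C. AE x in circle_measure. cmod (f x) \<le> C)"

lemma square_integrable_0: "square_integrable (\<lambda>x. 0)"
  by (simp add: square_integrable_def)

lemma square_integrable_mult:
  assumes "essentially_bounded \<phi>" "square_integrable g"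
  shows "square_integrable (\<lambda>x. \<phi> x * g x)"
proof -
  from assms(1) obtain C where C: "AE x in circle_measure. cmod (\<phi> x) \<le> C"
    and m [measurable]: "\<phi> \<in> borel_measurable circle_measure"
    by (auto simp: essentially_bounded_def)
  from assms(2) have g [measurable]: "g \<in> borel_measurable circle_measure"
    and i: "integrable circle_measure (\<lambda>x. (cmod (g x))\<^sup>2)"
    by (auto simp: square_integrable_def)
  have "integrable circle_measure (\<lambda>x. C\<^sup>2 * (cmod (g x))\<^sup>2)"
    using i by simp
  then have "integrable circle_measure (\<lambda>x. (cmod (\<phi> x * g x))\<^sup>2)"
  proof (rule Bochner_Integration.integrable_bound)
    show "AE x in circle_measure. norm ((cmod (\<phi> x * g x))\<^sup>2) \<le> norm (C\<^sup>2 * (cmod (g x))\<^sup>2)"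
      using C
    proof eventually_elim
      case (elim x)
      then have "(cmod (\<phi> x))\<^sup>2 \<le> C\<^sup>2" by (intro power_mono) auto
      then show ?case
        by (simp add: norm_mult power_mult_distrib mult_right_mono)
    qed
  qed measurable
  then show ?thesis by (simp add: square_integrable_def)
qed

lemma square_integrable_mult_if:
  "square_integrable g \<Longrightarrow>
     square_integrable (\<lambda>x. if essentially_bounded \<phi> then \<phi> x * g x else 0)"
  by (cases "essentially_bounded \<phi>") (simp_all add: square_integrable_mult square_integrable_0)

lemma essentially_bounded_const: "essentially_bounded (\<lambda>x. c)"
  by (auto simp: essentially_bounded_def intro!: exI[of _ "cmod c"])

lemma square_integrable_add:
  assumes "square_integrable f" "square_integrable g"
  shows "square_integrable (\<lambda>x. f x + g x)"
proof -
  from assms have [measurable]: "f \<in> borel_measurable circle_measure"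
    "g \<in> borel_measurable circle_measure"
    and i: "integrable circle_measure (\<lambda>x. (cmod (f x))\<^sup>2)"
      "integrable circle_measure (\<lambda>x. (cmod (g x))\<^sup>2)"
    by (auto simp: square_integrable_def)
  have "integrable circle_measure (\<lambda>x. 2 * (cmod (f x))\<^sup>2 + 2 * (cmod (g x))\<^sup>2)"
    using i by simp
  then have "integrable circle_measure (\<lambda>x. (cmod (f x + g x))\<^sup>2)"
  proof (rule Bochner_Integration.integrable_bound)
    have "(cmod (f x + g x))\<^sup>2 \<le> 2 * (cmod (f x))\<^sup>2 + 2 * (cmod (g x))\<^sup>2" for x
    proof -
      have "(cmod (f x + g x))\<^sup>2 \<le> (cmod (f x) + cmod (g x))\<^sup>2"
        by (intro power_mono norm_triangle_ineq) auto
      also have "\<dots> \<le> 2 * (cmod (f x))\<^sup>2 + 2 * (cmod (g x))\<^sup>2"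
        using sum_squares_bound[of "cmod (f x)" "cmod (g x)"] by (simp add: power2_sum)
      finally show ?thesis .
    qed
    then show "AE x in circle_measure.
        norm ((cmod (f x + g x))\<^sup>2) \<le> norm (2 * (cmod (f x))\<^sup>2 + 2 * (cmod (g x))\<^sup>2)"
      by simp
  qed measurable
  then show ?thesis by (simp add: square_integrable_def)
qed

lemma square_integrable_cmul: "square_integrable f \<Longrightarrow> square_integrable (\<lambda>x. c * f x)"
  using square_integrable_mult[OF essentially_bounded_const] .

lemma square_integrable_minus: "square_integrable f \<Longrightarrow> square_integrable (\<lambda>x. - f x)"
  using square_integrable_cmul[of f "-1"] by simp

lemma square_integrable_diff:
  "square_integrable f \<Longrightarrow> square_integrable g \<Longrightarrow> square_integrable (\<lambda>x. f x - g x)"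
  using square_integrable_add[OF _ square_integrable_minus[of g], of f] by simp

lemma square_integrable_scaleR:
  "square_integrable f \<Longrightarrow> square_integrable (\<lambda>x. r *\<^sub>R f x)"
  using square_integrable_cmul[of f "of_real r"] by (simp add: scaleR_conv_of_real)

lemma integrable_inner_circle:
  assumes "square_integrable f" "square_integrable g"
  shows "integrable circle_measure (\<lambda>x. f x \<bullet> g x)"
proof -
  from assms have [measurable]: "f \<in> borel_measurable circle_measure"
    "g \<in> borel_measurable circle_measure"
    and i: "integrable circle_measure (\<lambda>x. (cmod (f x))\<^sup>2)"
      "integrable circle_measure (\<lambda>x. (cmod (g x))\<^sup>2)"
    by (auto simp: square_integrable_def)
  have "integrable circle_measure (\<lambda>x. (cmod (f x))\<^sup>2 + (cmod (g x))\<^sup>2)"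
    using i by simp
  then show ?thesis
  proof (rule Bochner_Integration.integrable_bound)
    have "\<bar>f x \<bullet> g x\<bar> \<le> (cmod (f x))\<^sup>2 + (cmod (g x))\<^sup>2" for x
    proof -
      have "\<bar>f x \<bullet> g x\<bar> \<le> cmod (f x) * cmod (g x)"
        by (rule Cauchy_Schwarz_ineq2)
      also have "\<dots> \<le> (cmod (f x))\<^sup>2 + (cmod (g x))\<^sup>2"
      proof -
        have "0 \<le> cmod (f x) * cmod (g x)" by simp
        then show ?thesis
          using sum_squares_bound[of "cmod (f x)" "cmod (g x)"] by linarith
      qed
      finally show ?thesis .
    qed
    then show "AE x in circle_measure.
        norm (f x \<bullet> g x) \<le> norm ((cmod (f x))\<^sup>2 + (cmod (g x))\<^sup>2)"
      by simp
  qed measurable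
qed

definition L2_rel :: "(complex \<Rightarrow> complex) \<Rightarrow> (complex \<Rightarrow> complex) \<Rightarrow> bool" where
  "L2_rel f g \<longleftrightarrow>
     square_integrable f \<and> square_integrable g \<and> (AE x in circle_measure. f x = g x)"

lemma part_equivp_L2_rel: "part_equivp L2_rel"
proof (rule part_equivpI)
  show "\<exists>f. L2_rel f f"
    using square_integrable_0 by (auto simp: L2_rel_def)
  show "symp L2_rel"
    by (auto simp: symp_def L2_rel_def elim: eventually_mono)
  show "transp L2_rel"
    by (auto simp: transp_def L2_rel_def elim: eventually_elim2)
qed

quotient_type L2_circle = "complex \<Rightarrow> complex" / partial: L2_rel
  by (rule part_equivp_L2_rel)

text \<open>
  The class inner product below is real, namely the real part of the Hermitian inner product;
  it induces the usual norm.
\<close>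

instantiation L2_circle :: real_inner
begin

lift_definition zero_L2_circle :: L2_circle is "\<lambda>x. 0"
  by (simp add: L2_rel_def square_integrable_0)

lift_definition plus_L2_circle :: "L2_circle \<Rightarrow> L2_circle \<Rightarrow> L2_circle" is "\<lambda>f g x. f x + g x"
  by (auto simp: L2_rel_def intro: square_integrable_add elim: eventually_elim2)

lift_definition uminus_L2_circle :: "L2_circle \<Rightarrow> L2_circle" is "\<lambda>f x. - f x"
  by (auto simp: L2_rel_def intro: square_integrable_minus elim: eventually_mono)

lift_definition minus_L2_circle :: "L2_circle \<Rightarrow> L2_circle \<Rightarrow> L2_circle" is "\<lambda>f g x. f x - g x"
  by (auto simp: L2_rel_def intro: square_integrable_diff elim: eventually_elim2)

lift_definition scaleR_L2_circle :: "real \<Rightarrow> L2_circle \<Rightarrow> L2_circle" is "\<lambda>r f x. r *\<^sub>R f x"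
  by (auto
      simp: L2_rel_def intro: square_integrable_scaleR elim: eventually_mono)

lift_definition inner_L2_circle :: "L2_circle \<Rightarrow> L2_circle \<Rightarrow> real" is
  "\<lambda>f g. integral\<^sup>L circle_measure (\<lambda>x. f x \<bullet> g x)"
  unfolding L2_rel_def square_integrable_def
  by (rule integral_cong_AE) (auto elim: eventually_elim2)

lift_definition norm_L2_circle :: "L2_circle \<Rightarrow> real" is
  "\<lambda>f. sqrt (integral\<^sup>L circle_measure (\<lambda>x. (cmod (f x))\<^sup>2))"
  unfolding L2_rel_def square_integrable_def real_sqrt_eq_iff
  by (rule integral_cong_AE) (auto elim: eventually_mono)

definition sgn_L2_circle :: "L2_circle \<Rightarrow> L2_circle" where
  "sgn_L2_circle f = inverse (norm f) *\<^sub>R f"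

definition dist_L2_circle :: "L2_circle \<Rightarrow> L2_circle \<Rightarrow> real" where
  "dist_L2_circle f g = norm (f - g)"

definition uniformity_L2_circle :: "(L2_circle \<times> L2_circle) filter" where
  "uniformity_L2_circle = (INF e\<in>{0<..}. principal {(x, y). dist x y < e})"

definition open_L2_circle :: "L2_circle set \<Rightarrow> bool" where
  "open_L2_circle U \<longleftrightarrow> (\<forall>x\<in>U. \<forall>\<^sub>F (x', y) in uniformity. x' = x \<longrightarrow> y \<in> U)"

instance
proof
  fix f g h :: L2_circle and r s :: real
  show "f + g + h = f + (g + h)"
    by transfer (auto simp: L2_rel_def add.assoc intro!: square_integrable_add)
  show "f + g = g + f"
    by transfer (auto simp: L2_rel_def add.commute intro!: square_integrable_add)
  show "0 + f = f"
    by transfer (auto simp: L2_rel_def)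
  show "- f + f = 0"
    by transfer (auto simp: L2_rel_def square_integrable_0)
  show "f - g = f + - g"
    by transfer (auto simp: L2_rel_def intro!: square_integrable_diff)
  show "r *\<^sub>R (f + g) = r *\<^sub>R f + r *\<^sub>R g"
    by transfer (auto simp: L2_rel_def scaleR_add_right 
        intro!: square_integrable_add square_integrable_scaleR)
  show "(r + s) *\<^sub>R f = r *\<^sub>R f + s *\<^sub>R f"
    by transfer (auto simp: L2_rel_def scaleR_add_left 
        intro!: square_integrable_add square_integrable_scaleR)
  show "r *\<^sub>R s *\<^sub>R f = (r * s) *\<^sub>R f"
    by transfer (auto simp: L2_rel_def 
        intro!: square_integrable_scaleR)
  show "1 *\<^sub>R f = f"
    by transfer (auto simp: L2_rel_def)
  show "dist f g = norm (f - g)"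
    by (rule dist_L2_circle_def)
  show "sgn f = inverse (norm f) *\<^sub>R f"
    by (rule sgn_L2_circle_def)
  show "uniformity = (INF e\<in>{0<..}. principal {(x, y). dist (x::L2_circle) y < e})"
    by (rule uniformity_L2_circle_def)
  show "open U \<longleftrightarrow> (\<forall>x\<in>U. \<forall>\<^sub>F (x', y) in uniformity. x' = x \<longrightarrow> y \<in> U)" for U :: "L2_circle set"
    by (rule open_L2_circle_def)
  show "f \<bullet> g = g \<bullet> f"
    by transfer (simp add: inner_commute)
  show "(f + g) \<bullet> h = f \<bullet> h + g \<bullet> h"
    by transfer
      (simp add: L2_rel_def inner_add_left Bochner_Integration.integral_add integrable_inner_circle)
  show "(r *\<^sub>R f) \<bullet> g = r * (f \<bullet> g)"
    by transfer simp
  show "0 \<le> f \<bullet> f"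
    by transfer simp
  show "f \<bullet> f = 0 \<longleftrightarrow> f = 0"
  proof transfer
    fix f assume "L2_rel f f"
    then have si: "square_integrable f" by (simp add: L2_rel_def)
    have "integral\<^sup>L circle_measure (\<lambda>x. f x \<bullet> f x) = 0 \<longleftrightarrow> (AE x in circle_measure. f x \<bullet> f x = 0)"
      using integrable_inner_circle[OF si si] by (intro integral_nonneg_eq_0_iff_AE) auto
    also have "\<dots> \<longleftrightarrow> L2_rel f (\<lambda>x. 0)"
      using si by (simp add: L2_rel_def square_integrable_0)
    finally show "integral\<^sup>L circle_measure (\<lambda>x. f x \<bullet> f x) = 0 \<longleftrightarrow> L2_rel f (\<lambda>x. 0)" .
  qed
  show "norm f = sqrt (f \<bullet> f)"
    by transfer (simp add: power2_norm_eq_inner)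
qed

end

lift_definition scaleC_L2 :: "complex \<Rightarrow> L2_circle \<Rightarrow> L2_circle" is "\<lambda>c f x. c * f x"
  by (auto simp: L2_rel_def intro: square_integrable_cmul elim: eventually_mono)

lift_definition mult_L2 :: "(complex \<Rightarrow> complex) \<Rightarrow> L2_circle \<Rightarrow> L2_circle" is
  "\<lambda>\<phi> g x. if essentially_bounded \<phi> then \<phi> x * g x else 0"
  by (auto simp: L2_rel_def intro: square_integrable_mult_if elim: eventually_mono)

lemma mult_L2_add: "mult_L2 \<phi> (f + g) = mult_L2 \<phi> f + mult_L2 \<phi> g"
  by transfer (auto simp: L2_rel_def distrib_left
      intro!: square_integrable_mult_if square_integrable_add)

lemma mult_L2_scaleR: "mult_L2 \<phi> (r *\<^sub>R f) = r *\<^sub>R mult_L2 \<phi> f"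
  by transfer (auto simp: L2_rel_def intro!: square_integrable_mult_if square_integrable_scaleR)

lemma norm_mult_L2_le:
  assumes "essentially_bounded \<phi>" "AE x in circle_measure. cmod (\<phi> x) \<le> C" "0 \<le> C"
  shows "norm (mult_L2 \<phi> g) \<le> C * norm g"
  using assms
proof (transfer fixing: \<phi> C)
  fix g assume "L2_rel g g"
  then have g: "square_integrable g" by (simp add: L2_rel_def)
  assume \<phi>: "essentially_bounded \<phi>" and C: "AE x in circle_measure. cmod (\<phi> x) \<le> C" "0 \<le> C"
  have "integral\<^sup>L circle_measure (\<lambda>x. (cmod (\<phi> x * g x))\<^sup>2) \<le>
      integral\<^sup>L circle_measure (\<lambda>x. C\<^sup>2 * (cmod (g x))\<^sup>2)"
  proof (rule integral_mono_AE)
    show "integrable circle_measure (\<lambda>x. (cmod (\<phi> x * g x))\<^sup>2)"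
      using square_integrable_mult[OF \<phi> g] by (simp add: square_integrable_def)
    show "integrable circle_measure (\<lambda>x. C\<^sup>2 * (cmod (g x))\<^sup>2)"
      using g by (simp add: square_integrable_def)
    show "AE x in circle_measure. (cmod (\<phi> x * g x))\<^sup>2 \<le> C\<^sup>2 * (cmod (g x))\<^sup>2"
      using C(1)
    proof eventually_elim
      case (elim x)
      then have "(cmod (\<phi> x))\<^sup>2 \<le> C\<^sup>2" by (intro power_mono) auto
      then show ?case
        by (simp add: norm_mult power_mult_distrib mult_right_mono)
    qed
  qed
  then have "sqrt (integral\<^sup>L circle_measure (\<lambda>x. (cmod (\<phi> x * g x))\<^sup>2)) \<le>
      sqrt (C\<^sup>2 * integral\<^sup>L circle_measure (\<lambda>x. (cmod (g x))\<^sup>2))"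
    by simp
  with C(2) \<phi> show "sqrt (integral\<^sup>L circle_measure
        (\<lambda>x. (cmod (if essentially_bounded \<phi> then \<phi> x * g x else 0))\<^sup>2)) \<le>
      C * sqrt (integral\<^sup>L circle_measure (\<lambda>x. (cmod (g x))\<^sup>2))"
    by (simp add: real_sqrt_mult)
qed

lemma bounded_linear_mult_L2: "bounded_linear (mult_L2 \<phi>)"
proof (cases "essentially_bounded \<phi>")
  case True
  then obtain C where C: "AE x in circle_measure. cmod (\<phi> x) \<le> C"
    by (auto simp: essentially_bounded_def)
  then have C': "AE x in circle_measure. cmod (\<phi> x) \<le> \<bar>C\<bar>"
    by (auto elim: eventually_mono)
  show ?thesis
    by (rule bounded_linear_intro[where K = "\<bar>C\<bar>"])
      (use norm_mult_L2_le[OF True C'] in \<open>auto simp: mult_L2_add mult_L2_scaleR mult.commute\<close>)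
next
  case False
  then have "mult_L2 \<phi> = (\<lambda>g. 0)"
    by (intro ext) (transfer fixing: \<phi>, simp add: L2_rel_def square_integrable_0)
  then show ?thesis by simp
qed

lemma scaleC_L2_eq_mult: "scaleC_L2 c = mult_L2 (\<lambda>x. c)"
  by (rule ext, transfer)
    (simp add: essentially_bounded_const L2_rel_def square_integrable_cmul)

lemma bounded_linear_scaleC_L2: "bounded_linear (scaleC_L2 c)"
  by (simp add: scaleC_L2_eq_mult bounded_linear_mult_L2)

text \<open>
  The multiplication operator \<open>g \<mapsto> \<phi> g\<close>; it is meaningful for essentially bounded \<open>\<phi>\<close>, and is
  zero by convention otherwise.
\<close>

definition mult_op :: "(complex \<Rightarrow> complex) \<Rightarrow> L2_circle \<Rightarrow>\<^sub>L L2_circle" where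
  "mult_op \<phi> = Blinfun (mult_L2 \<phi>)"

lemma mult_op_apply: "blinfun_apply (mult_op \<phi>) g = mult_L2 \<phi> g"
  by (simp add: mult_op_def bounded_linear_Blinfun_apply bounded_linear_mult_L2)

definition scaleC_op :: "complex \<Rightarrow> (L2_circle \<Rightarrow>\<^sub>L L2_circle) \<Rightarrow> (L2_circle \<Rightarrow>\<^sub>L L2_circle)" where
  "scaleC_op c A = Blinfun (\<lambda>g. scaleC_L2 c (blinfun_apply A g))"

lemma scaleC_op_apply: "blinfun_apply (scaleC_op c A) g = scaleC_L2 c (blinfun_apply A g)"
  by (simp add: scaleC_op_def bounded_linear_Blinfun_apply blinfun.bounded_linear_right
      bounded_linear_compose[OF bounded_linear_scaleC_L2])

text \<open>
  The library's bounded linear operators are only real linear. The algebra of bounded operators on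
  the complex Hilbert space consists of the complex linear ones, for which the real operator norm
  is the usual one.
\<close>

definition B_L2 :: "(L2_circle \<Rightarrow>\<^sub>L L2_circle) set" where
  "B_L2 = {A. \<forall>c g. blinfun_apply A (scaleC_L2 c g) = scaleC_L2 c (blinfun_apply A g)}"

text \<open>
  Complex derivative with respect to the operator norm. As with the library's
  \<^const>\<open>has_field_derivative\<close>, it is a Frechet derivative of the form \<open>h \<mapsto> h D\<close>.
\<close>

definition has_op_derivative ::
  "(complex \<Rightarrow> L2_circle \<Rightarrow>\<^sub>L L2_circle) \<Rightarrow> (L2_circle \<Rightarrow>\<^sub>L L2_circle) \<Rightarrow> complex filter \<Rightarrow> bool"
    (infix "(has'_op'_derivative)" 50) where
  "(f has_op_derivative D) F \<longleftrightarrow> (f has_derivative (\<lambda>h. scaleC_op h D)) F"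

definition op_deriv ::
  "(complex \<Rightarrow> L2_circle \<Rightarrow>\<^sub>L L2_circle) \<Rightarrow> complex \<Rightarrow> L2_circle \<Rightarrow>\<^sub>L L2_circle" where
  "op_deriv f z = (SOME D. (f has_op_derivative D) (at z))"

definition op_holomorphic_on ::
  "(complex \<Rightarrow> L2_circle \<Rightarrow>\<^sub>L L2_circle) \<Rightarrow> complex set \<Rightarrow> bool" (infixl "op'_holomorphic'_on" 50) where
  "f op_holomorphic_on S \<longleftrightarrow>
     f ` S \<subseteq> B_L2 \<and> (\<forall>z\<in>S. \<exists>D. (f has_op_derivative D) (at z within S))"

end

theory Submission
  imports Defs
begin

text \<open>
  If \<open>F = p + q\<close> is bounded by 1 on the bidisc, restrict it to the lines \<open>l \<mapsto> (l, l \<zeta>)\<close>. The Taylor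
  coefficients of these restrictions are entire functions of \<open>\<zeta>\<close> which Cauchy's estimates bound by
  \<open>max 1 \<bar>\<zeta>\<bar> ^ k\<close>, so they are polynomials \<open>P\<^sub>k\<close> of degree at most \<open>k\<close>, and \<open>f(l)\<close> is multiplication
  by \<open>\<zeta> \<mapsto> F(l, l \<zeta>)\<close> on the circle. The inequality between \<open>p\<^sub>1\<close> and \<open>p\<^sub>2\<close> is the Schwarz-Pick lemma for
  \<open>F(l, l z) / l\<close>. Conversely, the norm of a multiplication operator with continuous symbol is the
  supremum of the symbol, so \<open>\<bar>P\<^sub>k\<bar> \<le> 1\<close> on the circle and the homogeneous polynomials
  \<open>z\<^sub>1\<^sup>k P\<^sub>k(z\<^sub>2 / z\<^sub>1)\<close> sum to a holomorphic function that is bounded by \<open>\<parallel>f\<parallel>\<close> on every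
  torus \<open>\<bar>z\<^sub>1\<bar> = \<bar>z\<^sub>2\<bar> = r < 1\<close>, hence on the bidisc by the maximum principle.
\<close>

text \<open>Holomorphy is assumed to first order only: for functions on the bidisc it means a
  complex linear Frechet derivative at every point, and \<open>op_deriv\<close> picks a derivative
  by choice. Power series are thus a conclusion on both sides. In two variables they are avoided: a
  line through the origin needs one-variable series only, and the condition on \<open>q\<close> is
  translated into a third-order remainder, uniform in both variables, from which Cauchy's estimates
  recover the derivatives. For operators the series is found weakly, from scalar functions; its norm
  convergence and the operator-valued integrals rest on completeness, hence the Riesz-Fischer
  argument below. The lines \<open>(l, l * \<zeta>)\<close> miss the axis where the first coordinate
  vanishes; that axis is reached by continuity or by the maximum principle. As the functions live on
  open discs and their bounds by 1 are not strict, radii and factors below 1 are introduced and then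
  sent to 1.\<close>

section \<open>Completeness of the Hilbert space\<close>

lemma measurable_cis_circle: "cis \<in> borel \<rightarrow>\<^sub>M restrict_space borel (sphere 0 1)"
  by (intro measurable_restrict_space2 borel_measurable_continuous_onI continuous_intros) auto

lemma space_circle_measure: "space circle_measure = sphere 0 1"
  by (simp add: circle_measure_def space_restrict_space)

lemma sets_circle_measure: "sets circle_measure = sets (restrict_space borel (sphere 0 1))"
  by (simp add: circle_measure_def)

lemma emeasure_circle_measure:
  assumes "A \<in> sets circle_measure"
  shows "emeasure circle_measure A = emeasure lborel ({0..<2 * pi} \<inter> cis -` A) / ennreal (2 * pi)"
proof -
  have m: "cis \<in> uniform_measure lborel {0..<2 * pi} \<rightarrow>\<^sub>M restrict_space borel (sphere 0 1)"
    using measurable_cis_circle by simp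
  have "A \<in> sets (restrict_space borel (sphere 0 1))"
    using assms by (simp add: sets_circle_measure)
  with measurable_sets[OF m this] show ?thesis
    by (simp add: circle_measure_def emeasure_distr[OF m])
qed

lemma emeasure_space_circle_measure: "emeasure circle_measure (space circle_measure) = 1"
proof -
  have "cis -` sphere 0 1 = UNIV" by auto
  then show ?thesis
    using emeasure_circle_measure[OF sets.top]
    by (simp add: space_circle_measure ennreal_divide_self)
qed

lemma borel_measurable_circle:
  assumes "continuous_on (sphere 0 1) \<phi>"
  shows "\<phi> \<in> borel_measurable circle_measure"
  using borel_measurable_continuous_on_restrict[OF assms]
  by (simp add: measurable_cong_sets[OF sets_circle_measure refl])

lemma essentially_bounded_continuous:
  assumes "continuous_on (sphere 0 1) \<phi>"
  shows "essentially_bounded \<phi>"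
proof -
  have "compact (\<phi> ` sphere 0 1)"
    using assms by (intro compact_continuous_image) auto
  then obtain C where "\<And>x. x \<in> sphere 0 1 \<Longrightarrow> cmod (\<phi> x) \<le> C"
    by (metis bounded_iff compact_imp_bounded imageI)
  then have "AE x in circle_measure. cmod (\<phi> x) \<le> C"
    by (intro AE_I2) (auto simp: space_circle_measure)
  with borel_measurable_circle[OF assms] show ?thesis
    by (auto simp: essentially_bounded_def)
qed

lemma L2_circle_cases:
  obtains f where "square_integrable f" "u = abs_L2_circle f"
  by (metis Quotient3_L2_circle Quotient3_abs_rep Quotient3_rel_rep L2_rel_def Quotient3_def)

lemma L2_rel_refl: "L2_rel f f \<longleftrightarrow> square_integrable f"
  by (simp add: L2_rel_def)

lemma norm_abs_L2_circle:
  "square_integrable f \<Longrightarrow>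
     norm (abs_L2_circle f) = sqrt (integral\<^sup>L circle_measure (\<lambda>x. (cmod (f x))\<^sup>2))"
  by (simp add: norm_L2_circle.abs_eq eq_onp_def L2_rel_refl)

lemma diff_abs_L2_circle:
  "square_integrable f \<Longrightarrow> square_integrable g \<Longrightarrow>
     abs_L2_circle f - abs_L2_circle g = abs_L2_circle (\<lambda>x. f x - g x)"
  by (simp add: minus_L2_circle.abs_eq L2_rel_refl)

lemma nn_integral_norm_L2_circle:
  assumes "square_integrable f"
  shows "(\<integral>\<^sup>+ x. ennreal ((cmod (f x))\<^sup>2) \<partial>circle_measure) = ennreal ((norm (abs_L2_circle f))\<^sup>2)"
proof -
  have "(norm (abs_L2_circle f))\<^sup>2 = integral\<^sup>L circle_measure (\<lambda>x. (cmod (f x))\<^sup>2)"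
    using assms by (simp add: norm_abs_L2_circle)
  then show ?thesis
    using assms by (simp add: nn_integral_eq_integral square_integrable_def)
qed

text \<open>Cauchy-Schwarz against the constant function 1, whose integral is 1 because arc length
  is normalised.\<close>

lemma nn_integral_le_norm_L2_circle:
  assumes f: "square_integrable f"
  shows "(\<integral>\<^sup>+ x. ennreal (cmod (f x)) \<partial>circle_measure) \<le> ennreal (norm (abs_L2_circle f))"
proof -
  have [measurable]: "f \<in> borel_measurable circle_measure"
    using f by (auto simp: square_integrable_def)
  have "(\<integral>\<^sup>+ x. ennreal (cmod (f x)) * 1 \<partial>circle_measure)\<^sup>2
      \<le> (\<integral>\<^sup>+ x. (ennreal (cmod (f x)))\<^sup>2 \<partial>circle_measure) * (\<integral>\<^sup>+ x. 1\<^sup>2 \<partial>circle_measure)"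
    by (rule Cauchy_Schwarz_nn_integral) measurable
  also have "\<dots> = (ennreal (norm (abs_L2_circle f)))\<^sup>2"
    by (simp add: emeasure_space_circle_measure ennreal_power nn_integral_norm_L2_circle[OF f])
  finally show ?thesis
    by (cases "\<integral>\<^sup>+ x. ennreal (cmod (f x)) \<partial>circle_measure")
      (auto simp: ennreal_power power2_le_iff_abs_le top_power_ennreal top_unique)
qed

text \<open>Riesz-Fischer. The L1 norms of consecutive differences have a finite sum, so the
  telescoping series converges absolutely almost everywhere. Fatou's lemma then bounds the L2
  distance to the pointwise limit.\<close>

lemma L2_circle_fast_Cauchy_converges:
  fixes X :: "nat \<Rightarrow> L2_circle"
  assumes fast: "\<And>m n. m \<ge> n \<Longrightarrow> norm (X m - X n) \<le> (1/2)^n"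
  shows "convergent X"
proof -
  let ?M = circle_measure
  have "\<exists>g. square_integrable g \<and> X n = abs_L2_circle g" for n
    by (meson L2_circle_cases)
  then obtain g where g: "\<And>n. square_integrable (g n)" and X: "\<And>n. X n = abs_L2_circle (g n)"
    by metis
  have [measurable]: "g n \<in> borel_measurable ?M" for n
    using g[of n] by (simp add: square_integrable_def)
  have gg: "square_integrable (\<lambda>x. g m x - g n x)" for m n
    by (rule square_integrable_diff[OF g g])
  have nd: "norm (X m - X n) = norm (abs_L2_circle (\<lambda>x. g m x - g n x))" for m n
    by (simp add: X diff_abs_L2_circle g)
  have "(\<integral>\<^sup>+ x. (\<Sum>n. ennreal (cmod (g (Suc n) x - g n x))) \<partial>?M)
      = (\<Sum>n. \<integral>\<^sup>+ x. ennreal (cmod (g (Suc n) x - g n x)) \<partial>?M)"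
    by (rule nn_integral_suminf) measurable
  also have "\<dots> \<le> (\<Sum>n. ennreal ((1/2)^n))"
  proof (rule suminf_le)
    fix n
    have "(\<integral>\<^sup>+ x. ennreal (cmod (g (Suc n) x - g n x)) \<partial>?M) \<le> ennreal (norm (X (Suc n) - X n))"
      unfolding nd by (rule nn_integral_le_norm_L2_circle[OF gg])
    also have "\<dots> \<le> ennreal ((1/2)^n)"
      using fast[of n "Suc n"] by (intro ennreal_leI) auto
    finally show "(\<integral>\<^sup>+ x. ennreal (cmod (g (Suc n) x - g n x)) \<partial>?M) \<le> ennreal ((1/2)^n)" .
  qed auto
  also have "\<dots> = ennreal (\<Sum>n. (1/2)^n)"
    by (intro suminf_ennreal2) (auto intro: summable_geometric)
  also have "\<dots> < \<infinity>" by simp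
  finally have "AE x in ?M. (\<Sum>n. ennreal (cmod (g (Suc n) x - g n x))) \<noteq> \<infinity>"
    by (intro nn_integral_PInf_AE) (auto simp: less_top)
  then have conv: "AE x in ?M. convergent (\<lambda>n. g n x)"
  proof eventually_elim
    case (elim x)
    then have "summable (\<lambda>n. cmod (g (Suc n) x - g n x))"
      by (intro summable_suminf_not_top) (auto simp: infinity_ennreal_def)
    then have "summable (\<lambda>n. g (Suc n) x - g n x)"
      by (rule summable_norm_cancel)
    then have "convergent (\<lambda>n. \<Sum>i<n. g (Suc i) x - g i x)"
      by (simp add: summable_iff_convergent)
    then have "convergent (\<lambda>n. g n x - g 0 x)"
      by (simp add: sum_lessThan_telescope[of "\<lambda>i. g i x"])
    then have "convergent (\<lambda>n. (g n x - g 0 x) + g 0 x)"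
      by (intro convergent_add convergent_const)
    then show ?case by simp
  qed
  \<comment> \<open>Where the sequence diverges \<open>lim\<close> has no meaningful value, but this
    happens on a null set only, and \<open>h\<close> stays measurable.\<close>
  define h where "h x = lim (\<lambda>n. g n x)" for x
  have [measurable]: "h \<in> borel_measurable ?M"
    unfolding h_def by measurable
  have lim: "AE x in ?M. (\<lambda>n. g n x) \<longlonglongrightarrow> h x"
    using conv by eventually_elim (simp add: h_def convergent_LIMSEQ_iff)
  have bound: "(\<integral>\<^sup>+ x. ennreal ((cmod (h x - g n x))\<^sup>2) \<partial>?M) \<le> ennreal (((1/2)^n)\<^sup>2)" for n
  proof -
    have "(\<integral>\<^sup>+ x. ennreal ((cmod (h x - g n x))\<^sup>2) \<partial>?M)
        = (\<integral>\<^sup>+ x. liminf (\<lambda>m. ennreal ((cmod (g m x - g n x))\<^sup>2)) \<partial>?M)"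
    proof (rule nn_integral_cong_AE)
      show "AE x in ?M. ennreal ((cmod (h x - g n x))\<^sup>2)
          = liminf (\<lambda>m. ennreal ((cmod (g m x - g n x))\<^sup>2))"
        using lim
      proof eventually_elim
        case (elim x)
        have "(\<lambda>m. ennreal ((cmod (g m x - g n x))\<^sup>2)) \<longlonglongrightarrow> ennreal ((cmod (h x - g n x))\<^sup>2)"
          by (intro tendsto_intros elim) 
        then show ?case
          by (rule lim_imp_Liminf[OF sequentially_bot, symmetric])
      qed
    qed
    also have "\<dots> \<le> liminf (\<lambda>m. \<integral>\<^sup>+ x. ennreal ((cmod (g m x - g n x))\<^sup>2) \<partial>?M)"
      by (rule nn_integral_liminf) measurable
    also have "\<dots> \<le> liminf (\<lambda>m. ennreal (((1/2)^n)\<^sup>2))"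
    proof (rule Liminf_mono)
      show "\<forall>\<^sub>F m in sequentially. (\<integral>\<^sup>+ x. ennreal ((cmod (g m x - g n x))\<^sup>2) \<partial>?M) \<le> ennreal (((1/2)^n)\<^sup>2)"
        using eventually_ge_at_top[of n]
      proof eventually_elim
        case (elim m)
        then have "(norm (abs_L2_circle (\<lambda>x. g m x - g n x)))\<^sup>2 \<le> ((1/2)^n)\<^sup>2"
          using fast[of n m] unfolding nd by (intro power_mono) auto
        then show ?case
          unfolding nn_integral_norm_L2_circle[OF gg] by (rule ennreal_leI)
      qed
    qed
    also have "\<dots> = ennreal (((1/2)^n)\<^sup>2)" by (simp add: Liminf_const)
    finally show ?thesis .
  qed
  have dsi: "square_integrable (\<lambda>x. h x - g n x)" for n
    unfolding square_integrable_def
  proof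
    show "integrable ?M (\<lambda>x. (cmod (h x - g n x))\<^sup>2)"
    proof (rule integrableI_bounded)
      show "(\<integral>\<^sup>+ x. ennreal (norm ((cmod (h x - g n x))\<^sup>2)) \<partial>?M) < \<infinity>"
        using bound[of n] by (auto intro: order.strict_trans1)
    qed measurable
  qed measurable
  \<comment> \<open>The limit is \<open>h - g 0\<close> plus \<open>g 0\<close>, and Fatou's lemma
    has just controlled the first summand.\<close>
  have hsi: "square_integrable h"
    using square_integrable_add[OF dsi[of 0] g[of 0]] by simp
  have "norm (abs_L2_circle h - X n) \<le> (1/2)^n" for n
  proof -
    have "ennreal ((norm (abs_L2_circle (\<lambda>x. h x - g n x)))\<^sup>2) \<le> ennreal (((1/2)^n)\<^sup>2)"
      using bound[of n] unfolding nn_integral_norm_L2_circle[OF dsi] .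
    then have "(norm (abs_L2_circle (\<lambda>x. h x - g n x)))\<^sup>2 \<le> ((1/2)^n)\<^sup>2"
      by (simp add: ennreal_le_iff)
    then have "norm (abs_L2_circle (\<lambda>x. h x - g n x)) \<le> (1/2)^n"
      by (rule power2_le_imp_le) simp
    then show ?thesis by (simp add: X diff_abs_L2_circle g hsi)
  qed
  then have "(\<lambda>n. X n - abs_L2_circle h) \<longlonglongrightarrow> 0"
    by (intro Lim_null_comparison[OF _ LIMSEQ_realpow_zero[of "1/2"]])
      (auto simp: norm_minus_commute)
  then show ?thesis
    unfolding convergent_def using LIM_zero_cancel by blast
qed

text \<open>Completeness passes from the space to its bounded operators, so absolutely convergent
  operator series converge and continuous operator-valued functions on an interval are
  integrable.\<close>

instance L2_circle :: banach
proof
  fix X :: "nat \<Rightarrow> L2_circle"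
  assume X: "Cauchy X"
  have "\<exists>N. \<forall>m\<ge>N. \<forall>n\<ge>N. norm (X m - X n) < (1/2)^k" for k
    using X unfolding Cauchy_iff by (metis half_gt_zero_iff zero_less_one zero_less_power)
  then obtain N where N: "\<And>k m n. m \<ge> N k \<Longrightarrow> n \<ge> N k \<Longrightarrow> norm (X m - X n) < (1/2)^k"
    by metis
  \<comment> \<open>The sum dominates every \<open>N i\<close> with \<open>i \<le> k\<close>; the
    extra summand \<open>k\<close> makes \<open>r\<close> strictly increasing.\<close>
  define r where "r k = (\<Sum>i\<le>k. N i) + k" for k
  have r: "strict_mono r"
    by (rule strict_mono_Suc_iff[THEN iffD2]) (simp add: r_def)
  have rN: "r m \<ge> N k" if "m \<ge> k" for m k
    unfolding r_def using member_le_sum[of k "{..m}" N] that by (simp add: trans_le_add1)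
  have "convergent (X \<circ> r)"
    by (rule L2_circle_fast_Cauchy_converges) (auto intro!: less_imp_le N rN)
  then show "convergent X"
    using Cauchy_converges_subseq[OF X r] by (auto simp: convergent_def)
qed

section \<open>Multiplication operators\<close>

lemma norm_scaleC_L2: "norm (scaleC_L2 c u) = cmod c * norm u"
proof -
  obtain f where f: "square_integrable f" and u: "u = abs_L2_circle f"
    by (rule L2_circle_cases)
  have "scaleC_L2 c u = abs_L2_circle (\<lambda>x. c * f x)"
    by (simp add: u scaleC_L2.abs_eq L2_rel_refl f)
  then show ?thesis
    by (simp add: u f norm_abs_L2_circle square_integrable_cmul norm_mult power_mult_distrib
        real_sqrt_mult)
qed

lemma scaleC_L2_simps:
  "scaleC_L2 (a + b) u = scaleC_L2 a u + scaleC_L2 b u"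
  "scaleC_L2 a (u + v) = scaleC_L2 a u + scaleC_L2 a v"
  "scaleC_L2 a (scaleC_L2 b u) = scaleC_L2 (a * b) u"
  "scaleC_L2 (r *\<^sub>R a) u = r *\<^sub>R scaleC_L2 a u"
  "scaleC_L2 a (r *\<^sub>R u) = r *\<^sub>R scaleC_L2 a u"
  "scaleC_L2 1 u = u" "scaleC_L2 0 u = 0" "scaleC_L2 a 0 = 0"
  by (transfer, auto simp: L2_rel_def algebra_simps
        intro!: square_integrable_add square_integrable_cmul square_integrable_scaleR square_integrable_0)+

lemma scaleC_op_simps:
  "scaleC_op (a + b) A = scaleC_op a A + scaleC_op b A"
  "scaleC_op a (A + B) = scaleC_op a A + scaleC_op a B"
  "scaleC_op a (scaleC_op b A) = scaleC_op (a * b) A"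
  "scaleC_op (r *\<^sub>R a) A = r *\<^sub>R scaleC_op a A"
  "scaleC_op a (r *\<^sub>R A) = r *\<^sub>R scaleC_op a A"
  "scaleC_op 1 A = A" "scaleC_op 0 A = 0" "scaleC_op a 0 = 0"
  by (rule blinfun_eqI, simp add: scaleC_op_apply scaleC_L2_simps blinfun.bilinear_simps)+

lemma norm_scaleC_op_le: "norm (scaleC_op c A) \<le> cmod c * norm A"
  by (rule norm_blinfun_bound)
    (auto simp: scaleC_op_apply norm_scaleC_L2 mult.assoc intro!: mult_left_mono norm_blinfun)

lemma bounded_bilinear_scaleC_op: "bounded_bilinear scaleC_op"
  by (rule bounded_bilinear.intro)
    (auto simp: scaleC_op_simps intro!: exI[of _ 1] norm_scaleC_op_le)

lemma bounded_linear_scaleC_op: "bounded_linear (scaleC_op c)"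
  by (rule bounded_bilinear.bounded_linear_right[OF bounded_bilinear_scaleC_op])

lemma bounded_linear_scaleC_op_left: "bounded_linear (\<lambda>c. scaleC_op c A)"
  by (rule bounded_bilinear.bounded_linear_left[OF bounded_bilinear_scaleC_op])

lemma norm_scaleC_op: "norm (scaleC_op c A) = cmod c * norm A"
proof (cases "c = 0")
  case False
  have "norm A = norm (scaleC_op (inverse c) (scaleC_op c A))"
    using False by (simp add: scaleC_op_simps)
  also have "\<dots> \<le> cmod (inverse c) * norm (scaleC_op c A)"
    by (rule norm_scaleC_op_le)
  finally have "cmod c * norm A \<le> norm (scaleC_op c A)"
    using False by (simp add: norm_inverse norm_divide field_simps)
  with norm_scaleC_op_le[of c A] show ?thesis by simp
qed (simp add: scaleC_op_simps)

lemma subspace_B_L2: "subspace B_L2"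
  by (auto simp: subspace_def B_L2_def blinfun.bilinear_simps scaleC_L2_simps)

lemma scaleC_op_B_L2: "A \<in> B_L2 \<Longrightarrow> scaleC_op c A \<in> B_L2"
  by (auto simp: B_L2_def scaleC_op_apply scaleC_L2_simps mult.commute)

text \<open>This keeps the sum of an operator series complex linear, as a norm limit of complex
  linear partial sums.\<close>

lemma closed_B_L2: "closed B_L2"
proof -
  have "B_L2 = (\<Inter>c. \<Inter>g. {A. blinfun_apply A (scaleC_L2 c g) = scaleC_L2 c (blinfun_apply A g)})"
    by (auto simp: B_L2_def)
  also have "closed \<dots>"
    by (intro closed_INT ballI closed_Collect_eq bounded_linear.continuous_on[OF bounded_linear_scaleC_L2]
        bounded_linear.continuous_on[OF blinfun.bounded_linear_left] continuous_on_id)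
  finally show ?thesis .
qed

lemma mult_L2_scaleC: "mult_L2 \<phi> (scaleC_L2 c g) = scaleC_L2 c (mult_L2 \<phi> g)"
  by transfer (auto simp: L2_rel_def mult.left_commute
        intro!: square_integrable_mult_if square_integrable_cmul)

lemma mult_op_B_L2: "mult_op \<phi> \<in> B_L2"
  by (simp add: B_L2_def mult_op_apply mult_L2_scaleC)

lemma mult_L2_abs:
  "essentially_bounded \<phi> \<Longrightarrow> square_integrable g \<Longrightarrow>
     mult_L2 \<phi> (abs_L2_circle g) = abs_L2_circle (\<lambda>x. \<phi> x * g x)"
  by (simp add: mult_L2.abs_eq L2_rel_refl)

lemma mult_op_add:
  assumes "continuous_on (sphere 0 1) \<phi>" "continuous_on (sphere 0 1) \<psi>"
  shows "mult_op (\<lambda>x. \<phi> x + \<psi> x) = mult_op \<phi> + mult_op \<psi>"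
proof (rule blinfun_eqI)
  note eb = assms[THEN essentially_bounded_continuous]
    essentially_bounded_continuous[OF continuous_on_add[OF assms]]
  fix u show "mult_op (\<lambda>x. \<phi> x + \<psi> x) u = (mult_op \<phi> + mult_op \<psi>) u"
  proof (cases u rule: L2_circle_cases)
    case (1 g)
    then show ?thesis
      by (simp add: mult_op_apply blinfun.bilinear_simps eb mult_L2_abs plus_L2_circle.abs_eq
          L2_rel_refl square_integrable_mult distrib_right)
  qed
qed

lemma mult_op_cmul:
  assumes "continuous_on (sphere 0 1) \<phi>"
  shows "mult_op (\<lambda>x. c * \<phi> x) = scaleC_op c (mult_op \<phi>)"
proof (rule blinfun_eqI)
  note eb = essentially_bounded_continuous[OF assms]
    essentially_bounded_continuous[OF continuous_on_mult_left[OF assms]]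
  fix u show "mult_op (\<lambda>x. c * \<phi> x) u = scaleC_op c (mult_op \<phi>) u"
  proof (cases u rule: L2_circle_cases)
    case (1 g)
    then show ?thesis
      by (simp add: mult_op_apply scaleC_op_apply eb mult_L2_abs scaleC_L2.abs_eq
          L2_rel_refl square_integrable_mult mult.assoc)
  qed
qed

lemma mult_op_zero: "mult_op (\<lambda>x. 0) = 0"
  using mult_op_cmul[of "\<lambda>x. 0" 0] by (simp add: scaleC_op_simps)

text \<open>Identifies partial sums of an operator series with multiplication by a finite sum of
  symbols, so that their norms can be compared with values on the circle.\<close>

lemma mult_op_sum:
  assumes "\<And>i. i \<in> I \<Longrightarrow> continuous_on (sphere 0 1) (\<phi> i)"
  shows "mult_op (\<lambda>x. \<Sum>i\<in>I. c i * \<phi> i x) = (\<Sum>i\<in>I. scaleC_op (c i) (mult_op (\<phi> i)))"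
  using assms
proof (induction I rule: infinite_finite_induct)
  case (insert i I)
  then show ?case
    by (simp add: mult_op_add mult_op_cmul continuous_on_mult_left continuous_on_sum)
qed (simp_all add: mult_op_zero)

lemma norm_mult_op_le:
  assumes "continuous_on (sphere 0 1) \<phi>" "\<And>x. x \<in> sphere 0 1 \<Longrightarrow> cmod (\<phi> x) \<le> C" "0 \<le> C"
  shows "norm (mult_op \<phi>) \<le> C"
proof (rule norm_blinfun_bound)
  show "norm (mult_op \<phi> g) \<le> C * norm g" for g
    unfolding mult_op_apply using assms
    by (intro norm_mult_L2_le essentially_bounded_continuous AE_I2)
      (auto simp: space_circle_measure)
qed fact

text \<open>The preimage under \<open>cis\<close> is open and contains an argument of
  \<open>x\<close>, hence an interval of positive length.\<close>

lemma emeasure_circle_open_pos: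
  assumes "open U" "x \<in> U" "x \<in> sphere 0 1"
  shows "emeasure circle_measure (U \<inter> sphere 0 1) > 0"
proof -
  obtain t where t: "0 \<le> t" "t < 2 * pi" and x: "x = cis t"
    using assms(3) Arg2pi_ge_0[of x] Arg2pi_lt_2pi[of x] Arg2pi_eq[of x]
    by (auto simp: cis_conv_exp)
  have "open (cis -` U)"
    using assms(1) by (intro open_vimage continuous_intros)
  then obtain e where e: "e > 0" "ball t e \<subseteq> cis -` U"
    using assms(2) x open_contains_ball by (metis vimageI)
  \<comment> \<open>The interval to the right of \<open>t\<close>, cut at \<open>2 * pi\<close>,
    stays in the parameter range even for \<open>t = 0\<close>; it is nonempty because
    \<open>t < 2 * pi\<close>.\<close>
  define s where "s = min (t + e) (2 * pi)"
  have ts: "t < s" using t e by (simp add: s_def)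
  have sub: "{t<..<s} \<subseteq> {0..<2 * pi} \<inter> cis -` (U \<inter> sphere 0 1)"
    using t e by (auto simp: s_def dist_real_def intro!: subsetD[OF e(2)])
  have meas: "U \<inter> sphere 0 1 \<in> sets circle_measure"
    using assms(1) by (auto simp: sets_circle_measure sets_restrict_space)
  have "0 < emeasure lborel {t<..<s}"
    using ts by simp
  also have "\<dots> \<le> emeasure lborel ({0..<2 * pi} \<inter> cis -` (U \<inter> sphere 0 1))"
  proof (rule emeasure_mono[OF sub])
    have "cis -` (U \<inter> sphere 0 1) = cis -` U" by auto
    with \<open>open (cis -` U)\<close> show "{0..<2 * pi} \<inter> cis -` (U \<inter> sphere 0 1) \<in> sets lborel"
      by auto
  qed
  finally show ?thesis
    by (simp add: emeasure_circle_measure[OF meas] ennreal_zero_less_divide)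
qed

text \<open>If the norm were smaller, pick \<open>C\<close> strictly between it and
  \<open>cmod (\<phi> x)\<close>. By continuity the modulus of the symbol exceeds \<open>C\<close>
  on a relatively open set, which has positive measure, and the indicator of that set is stretched
  by at least \<open>C\<close>.\<close>

lemma norm_le_norm_mult_op:
  assumes \<phi>: "continuous_on (sphere 0 1) \<phi>" and x: "x \<in> sphere 0 1"
  shows "cmod (\<phi> x) \<le> norm (mult_op \<phi>)"
proof (rule ccontr)
  assume "\<not> ?thesis"
  then have N: "norm (mult_op \<phi>) < cmod (\<phi> x)" by simp
  then obtain C where C: "norm (mult_op \<phi>) < C" "C < cmod (\<phi> x)"
    using dense by blast
  have C0: "0 \<le> C" using C norm_ge_zero[of "mult_op \<phi>"] by linarith
  have "continuous_on (sphere 0 1) (\<lambda>x. cmod (\<phi> x))"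
    by (intro continuous_intros \<phi>)
  then obtain U where U: "open U" "U \<inter> sphere 0 1 = (\<lambda>x. cmod (\<phi> x)) -` {C<..} \<inter> sphere 0 1"
    by (meson continuous_on_open_invariant open_greaterThan)
  let ?E = "U \<inter> sphere 0 1"
  have E: "?E \<in> sets circle_measure"
    using U(1) by (auto simp: sets_circle_measure sets_restrict_space)
  have "x \<in> U" using U(2) C x by auto
  have fin: "emeasure circle_measure ?E < \<infinity>"
  proof -
    have "emeasure circle_measure ?E \<le> emeasure circle_measure (space circle_measure)"
      by (rule emeasure_space)
    then show ?thesis
      using ennreal_one_less_top by (simp add: emeasure_space_circle_measure order.strict_trans1)
  qed
  then have pos: "measure circle_measure ?E > 0"
    using emeasure_circle_open_pos[OF U(1) \<open>x \<in> U\<close> x]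
    by (simp add: measure_def enn2real_positive_iff)
  define g :: "complex \<Rightarrow> complex" where "g = indicator ?E"
  have g2: "(cmod (g y))\<^sup>2 = indicator ?E y" for y
    by (simp add: g_def indicator_def)
  have gi: "integrable circle_measure (indicator ?E :: _ \<Rightarrow> real)"
    using E fin by (simp add: integrable_indicator_iff)
  have gs: "square_integrable g"
    unfolding square_integrable_def g2 using gi E by (simp add: g_def)
  note eb = essentially_bounded_continuous[OF \<phi>]
  have s: "square_integrable (\<lambda>y. \<phi> y * g y)"
    by (rule square_integrable_mult[OF eb gs])
  have "C\<^sup>2 * measure circle_measure ?E = integral\<^sup>L circle_measure (\<lambda>y. C\<^sup>2 * indicator ?E y)"
    using E by simp
  also have "\<dots> \<le> integral\<^sup>L circle_measure (\<lambda>y. (cmod (\<phi> y * g y))\<^sup>2)"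
  proof (rule integral_mono)
    fix y assume "y \<in> space circle_measure"
    show "C\<^sup>2 * indicator ?E y \<le> (cmod (\<phi> y * g y))\<^sup>2"
    proof (cases "y \<in> ?E")
      case True
      then have "C < cmod (\<phi> y)" using U(2) by auto
      then show ?thesis using True C0 by (auto simp: g_def intro!: power_mono)
    qed (auto simp: g_def)
  qed (use gi s in \<open>auto simp: square_integrable_def\<close>)
  also have "\<dots> = (norm (mult_op \<phi> (abs_L2_circle g)))\<^sup>2"
    by (simp add: mult_op_apply mult_L2_abs eb gs norm_abs_L2_circle s)
  also have "\<dots> \<le> (norm (mult_op \<phi>) * norm (abs_L2_circle g))\<^sup>2"
    by (intro power_mono norm_blinfun) auto
  also have "\<dots> = (norm (mult_op \<phi>))\<^sup>2 * measure circle_measure ?E"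
    using E by (simp add: power_mult_distrib norm_abs_L2_circle gs g2)
  finally have "C\<^sup>2 \<le> (norm (mult_op \<phi>))\<^sup>2"
    using pos by simp
  then show False using C C0 by (meson norm_ge_zero not_le power2_le_imp_le)
qed

section \<open>Operator-valued power series\<close>

definition op_series :: "(nat \<Rightarrow> L2_circle \<Rightarrow>\<^sub>L L2_circle) \<Rightarrow> complex \<Rightarrow> L2_circle \<Rightarrow>\<^sub>L L2_circle" where
  "op_series A z = (\<Sum>k. scaleC_op (z ^ k) (A k))"

definition op_diffs :: "(nat \<Rightarrow> L2_circle \<Rightarrow>\<^sub>L L2_circle) \<Rightarrow> nat \<Rightarrow> L2_circle \<Rightarrow>\<^sub>L L2_circle" where
  "op_diffs A k = real (Suc k) *\<^sub>R A (Suc k)"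

text \<open>The radius of convergence is at least 1. Unlike a uniform bound on the coefficients,
  this property is inherited by \<open>op_diffs\<close>.\<close>

definition summable_coeffs :: "(nat \<Rightarrow> L2_circle \<Rightarrow>\<^sub>L L2_circle) \<Rightarrow> bool" where
  "summable_coeffs A \<longleftrightarrow> (\<forall>r. 0 \<le> r \<longrightarrow> r < 1 \<longrightarrow> summable (\<lambda>k. norm (A k) * r ^ k))"

lemma summable_coeffs_bounded:
  assumes "\<And>k. norm (A k) \<le> C"
  shows "summable_coeffs A"
  unfolding summable_coeffs_def
proof (intro allI impI)
  fix r :: real assume r: "0 \<le> r" "r < 1"
  have "summable (\<lambda>k. C * r ^ k)"
    using r by (intro summable_mult summable_geometric) auto
  then show "summable (\<lambda>k. norm (A k) * r ^ k)"
    by (rule summable_comparison_test')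
      (use r assms in \<open>auto simp: abs_mult intro!: mult_right_mono\<close>)
qed

text \<open>Taking norms turns \<open>op_diffs\<close> into the scalar \<open>diffs\<close>, so
  termwise differentiation of the real power series of norms applies.\<close>

lemma summable_coeffs_diffs:
  assumes "summable_coeffs A"
  shows "summable_coeffs (op_diffs A)"
  unfolding summable_coeffs_def
proof (intro allI impI)
  fix r :: real assume r: "0 \<le> r" "r < 1"
  have "summable (\<lambda>k. diffs (\<lambda>k. norm (A k)) k * r ^ k)"
  proof (rule termdiff_converges[where K = 1])
    fix x :: real assume "norm x < 1"
    then have "summable (\<lambda>k. norm (A k) * \<bar>x\<bar> ^ k)"
      using assms by (simp add: summable_coeffs_def)
    then show "summable (\<lambda>k. norm (A k) * x ^ k)"
      by (rule summable_comparison_test') (simp add: abs_mult power_abs)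
  qed (use r in auto)
  then show "summable (\<lambda>k. norm (op_diffs A k) * r ^ k)"
    by (simp add: diffs_def op_diffs_def)
qed

lemma op_series_sums:
  assumes "summable_coeffs A" "cmod z < 1"
  shows "(\<lambda>k. scaleC_op (z ^ k) (A k)) sums op_series A z"
proof -
  have "summable (\<lambda>k. norm (A k) * cmod z ^ k)"
    using assms by (simp add: summable_coeffs_def)
  then have "summable (\<lambda>k. norm (scaleC_op (z ^ k) (A k)))"
    by (simp add: norm_scaleC_op norm_power mult.commute)
  then show ?thesis
    unfolding op_series_def by (rule summable_sums[OF summable_norm_cancel])
qed

lemma op_series_0: "op_series A 0 = A 0"
proof -
  have "(\<lambda>k. scaleC_op (0 ^ k) (A k)) = (\<lambda>k. if k = 0 then A k else 0)"
    by (rule ext) (simp add: scaleC_op_simps power_0_left)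
  then show ?thesis
    unfolding op_series_def by (simp only: sums_unique[OF sums_single[of 0 A], symmetric])
qed

text \<open>Termwise differentiation: on a ball of radius \<open>r < 1\<close> containing
  \<open>z\<close> the differentiated series converges uniformly by the Weierstrass test. The
  differential of a term is \<open>scaleC_op h (D n x)\<close>, so uniform convergence of the sums
  of \<open>D\<close> controls the differentials in all directions \<open>h\<close>.\<close>

lemma op_series_has_derivative:
  assumes A: "summable_coeffs A" and z: "cmod z < 1"
  shows "(op_series A has_op_derivative op_series (op_diffs A) z) (at z)"
proof -
  obtain r where r: "cmod z < r" "r < 1" using z dense by blast
  then have r0: "0 < r" using norm_ge_zero[of z] by linarith
  \<comment> \<open>For \<open>i = 0\<close> the truncated exponent \<open>i - 1\<close> does no
    harm, since the factor \<open>of_nat i\<close> vanishes.\<close>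
  define D where "D i x = scaleC_op (of_nat i * x ^ (i - 1)) (A i)" for i x
  have D_Suc: "D (Suc k) x = scaleC_op (x ^ k) (op_diffs A k)" for k x
  proof -
    have "of_nat (Suc k) * x ^ k = real (Suc k) *\<^sub>R (x ^ k)"
      by (simp only: scaleR_conv_of_real of_real_of_nat_eq)
    then show ?thesis
      by (simp only: D_def diff_Suc_1 op_diffs_def scaleC_op_simps)
  qed
  have D_sum: "(\<Sum>i. D i x) = op_series (op_diffs A) x" if "cmod x < 1" for x
  proof -
    have "(\<lambda>k. D (Suc k) x) sums op_series (op_diffs A) x"
      unfolding D_Suc by (rule op_series_sums[OF summable_coeffs_diffs[OF A] that])
    moreover have "D 0 x = 0" by (simp add: D_def scaleC_op_simps)
    ultimately have "(\<lambda>k. D k x) sums op_series (op_diffs A) x"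
      using sums_Suc[of "\<lambda>k. D k x"] by simp
    then show ?thesis by (rule sums_unique[symmetric])
  qed
  have "uniform_limit (ball 0 r) (\<lambda>n x. \<Sum>i<n. D i x) (\<lambda>x. \<Sum>i. D i x) sequentially"
  proof (rule Weierstrass_m_test)
    have "summable (\<lambda>k. norm (op_diffs A k) * r ^ k)"
      using summable_coeffs_diffs[OF A] r r0 by (simp add: summable_coeffs_def)
    then have "summable (\<lambda>k. real (Suc k) * r ^ (Suc k - 1) * norm (A (Suc k)))"
      by (simp add: op_diffs_def mult_ac)
    then show "summable (\<lambda>i. real i * r ^ (i - 1) * norm (A i))"
      by (subst (asm) summable_Suc_iff)
    show "norm (D i x) \<le> real i * r ^ (i - 1) * norm (A i)" if "x \<in> ball 0 r" for i x
      using that by (auto simp: D_def norm_scaleC_op norm_mult norm_power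
          intro!: mult_right_mono mult_left_mono power_mono)
  qed
  then have ul: "\<forall>\<^sub>F n in sequentially. \<forall>x\<in>ball 0 r. dist (\<Sum>i<n. D i x) (\<Sum>i. D i x) < e"
    if "e > 0" for e
    using that by (simp add: uniform_limit_iff)
  have "\<exists>g. \<forall>x\<in>ball 0 r. (\<lambda>n. scaleC_op (x ^ n) (A n)) sums (g x) \<and>
      (g has_derivative (\<lambda>h. scaleC_op h (\<Sum>i. D i x))) (at x within ball 0 r)"
  proof (rule has_derivative_series[where f' = "\<lambda>n x h. scaleC_op h (D n x)"])
    fix n and x :: complex
    have "((\<lambda>x. x ^ n) has_derivative (\<lambda>h. h * (of_nat n * x ^ (n - 1)))) (at x within ball 0 r)"
      using has_derivative_power[OF has_derivative_ident, of n x "ball 0 r"]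
      by (simp add: mult_ac)
    from bounded_linear.has_derivative[OF bounded_linear_scaleC_op_left this]
    show "((\<lambda>x. scaleC_op (x ^ n) (A n)) has_derivative (\<lambda>h. scaleC_op h (D n x)))
        (at x within ball 0 r)"
      by (simp add: D_def scaleC_op_simps)
  next
    fix e :: real assume "e > 0"
    show "\<forall>\<^sub>F n in sequentially. \<forall>x\<in>ball 0 r. \<forall>h. norm ((\<Sum>i<n. scaleC_op h (D i x))
        - scaleC_op h (\<Sum>i. D i x)) \<le> e * norm h"
      using ul[OF \<open>e > 0\<close>]
    proof eventually_elim
      case (elim n)
      show ?case
      proof (intro ballI allI)
        fix x h assume x: "x \<in> ball (0::complex) r"
        have "norm ((\<Sum>i<n. scaleC_op h (D i x)) - scaleC_op h (\<Sum>i. D i x))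
            = norm (scaleC_op h ((\<Sum>i<n. D i x) - (\<Sum>i. D i x)))"
          by (simp add: bounded_linear.linear[OF bounded_linear_scaleC_op] linear_diff linear_sum)
        also have "\<dots> \<le> cmod h * e"
          using elim x unfolding norm_scaleC_op
          by (intro mult_left_mono) (auto simp: dist_norm less_imp_le)
        finally show "norm ((\<Sum>i<n. scaleC_op h (D i x)) - scaleC_op h (\<Sum>i. D i x)) \<le> e * norm h"
          by (simp add: mult.commute)
      qed
    qed
  next
    show "(\<lambda>n. scaleC_op (0 ^ n) (A n)) sums op_series A 0"
      by (rule op_series_sums[OF A]) simp
  qed (use r0 in auto)
  then obtain g where g: "\<And>x. x \<in> ball 0 r \<Longrightarrow> (\<lambda>n. scaleC_op (x ^ n) (A n)) sums (g x)"
    and g': "\<And>x. x \<in> ball 0 r \<Longrightarrow>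
      (g has_derivative (\<lambda>h. scaleC_op h (\<Sum>i. D i x))) (at x within ball 0 r)"
    by blast
  have eq: "g x = op_series A x" if "x \<in> ball 0 r" for x
    using sums_unique[OF g[OF that]] by (simp add: op_series_def)
  have "(g has_derivative (\<lambda>h. scaleC_op h (\<Sum>i. D i z))) (at z)"
    using g'[of z] r by (simp add: at_within_open[of z "ball 0 r"])
  then have "(op_series A has_derivative (\<lambda>h. scaleC_op h (\<Sum>i. D i z))) (at z)"
    by (rule has_derivative_transform_within_open[where s = "ball 0 r"]) (use r eq in auto)
  then show ?thesis
    by (simp add: has_op_derivative_def D_sum z)
qed

text \<open>A Frechet derivative is unique, and the map sending \<open>h\<close> to
  \<open>scaleC_op h D\<close> gives back \<open>D\<close> at \<open>h = 1\<close>; so the choice in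
  \<open>op_deriv\<close> is unambiguous.\<close>

lemma op_deriv_unique:
  assumes "(f has_op_derivative D) (at z)"
  shows "op_deriv f z = D"
proof -
  have "(f has_op_derivative op_deriv f z) (at z)"
    unfolding op_deriv_def by (rule someI) (rule assms)
  with assms have "(\<lambda>h. scaleC_op h (op_deriv f z)) = (\<lambda>h. scaleC_op h D)"
    unfolding has_op_derivative_def by (rule has_derivative_unique[rotated])
  from fun_cong[OF this, of 1] show ?thesis
    by (simp add: scaleC_op_simps)
qed

section \<open>Iterated derivatives of operator series\<close>

lemma summable_coeffs_higher_diffs:
  "summable_coeffs A \<Longrightarrow> summable_coeffs ((op_diffs ^^ k) A)"
  by (induction k) (auto intro: summable_coeffs_diffs)

lemma has_op_derivative_eq_op_series:
  assumes "summable_coeffs A" "\<And>z. cmod z < 1 \<Longrightarrow> f z = op_series A z" "cmod z < 1"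
  shows "(f has_op_derivative op_series (op_diffs A) z) (at z)"
  using op_series_has_derivative[OF assms(1,3)] unfolding has_op_derivative_def
  by (rule has_derivative_transform_within_open[where s = "ball 0 1"])
    (use assms in auto)

text \<open>Outside the disc \<open>f\<close> is arbitrary. Derivatives are local, so agreement on
  the open disc passes from each derivative to the next.\<close>

lemma higher_op_deriv_series:
  assumes "summable_coeffs A" "\<And>z. cmod z < 1 \<Longrightarrow> f z = op_series A z" "cmod z < 1"
  shows "(op_deriv ^^ k) f z = op_series ((op_diffs ^^ k) A) z"
  using assms(3)
proof (induction k arbitrary: z)
  case (Suc k)
  have "((op_deriv ^^ k) f has_op_derivative op_series (op_diffs ((op_diffs ^^ k) A)) z) (at z)"
    by (rule has_op_derivative_eq_op_series)
      (use Suc summable_coeffs_higher_diffs[OF assms(1)] in auto)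
  then show ?case by (simp add: op_deriv_unique)
qed (use assms in auto)

lemma higher_op_diffs: "(op_diffs ^^ k) A j = (fact (j + k) / fact j) *\<^sub>R A (j + k)"
proof (induction k arbitrary: j)
  case (Suc k)
  have "(op_diffs ^^ Suc k) A j = real (Suc j) *\<^sub>R (op_diffs ^^ k) A (Suc j)"
    by (simp add: op_diffs_def)
  also have "\<dots> = (real (Suc j) * (fact (Suc (j + k)) / fact (Suc j))) *\<^sub>R A (j + Suc k)"
    by (simp add: Suc del: fact_Suc of_nat_Suc)
  also have "real (Suc j) * (fact (Suc (j + k)) / fact (Suc j)) = fact (j + Suc k) / fact j"
    by (simp add: fact_Suc[of j] del: fact_Suc)
  finally show ?case .
qed simp

lemma op_deriv_0_eq_coeff:
  assumes "summable_coeffs A" "\<And>z. cmod z < 1 \<Longrightarrow> f z = op_series A z"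
  shows "(op_deriv ^^ k) f 0 /\<^sub>R fact k = A k"
  using higher_op_deriv_series[OF assms, of 0 k]
  by (simp add: op_series_0 higher_op_diffs)

lemma op_series_B_L2:
  assumes "summable_coeffs A" "\<And>k. A k \<in> B_L2" "cmod z < 1"
  shows "op_series A z \<in> B_L2"
proof (rule closed_sequentially[OF closed_B_L2])
  show "(\<lambda>n. \<Sum>k<n. scaleC_op (z ^ k) (A k)) \<longlonglongrightarrow> op_series A z"
    using op_series_sums[OF assms(1,3)] by (simp add: sums_def)
  show "(\<Sum>k<n. scaleC_op (z ^ k) (A k)) \<in> B_L2" for n
    by (intro subspace_sum[OF subspace_B_L2] scaleC_op_B_L2 assms)
qed

lemma op_series_holomorphic:
  assumes "summable_coeffs A" "\<And>k. A k \<in> B_L2"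
  shows "op_series A op_holomorphic_on ball 0 1"
  unfolding op_holomorphic_on_def
proof safe
  fix z :: complex assume z: "z \<in> ball 0 1"
  then show "op_series A z \<in> B_L2"
    by (intro op_series_B_L2 assms) auto
  have "(op_series A has_op_derivative op_series (op_diffs A) z) (at z)"
    using z by (intro op_series_has_derivative assms) auto
  then show "\<exists>D. (op_series A has_op_derivative D) (at z within ball 0 1)"
    unfolding has_op_derivative_def using has_derivative_at_withinI by blast
qed

section \<open>Scalar functionals and Cauchy's formula for operator-valued functions\<close>

text \<open>The Hermitian inner product, linear in its first argument.\<close>

definition cinner_L2 :: "L2_circle \<Rightarrow> L2_circle \<Rightarrow> complex" where
  "cinner_L2 u v = Complex (u \<bullet> v) (u \<bullet> scaleC_L2 \<i> v)"

text \<open>A pointwise identity for the integrands. This skew symmetry is what makes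
  \<open>cinner_L2\<close> complex linear in its first argument.\<close>

lemma inner_scaleC_L2_i: "scaleC_L2 \<i> u \<bullet> v = - (u \<bullet> scaleC_L2 \<i> v)"
proof (cases u rule: L2_circle_cases)
  case (1 f)
  obtain g where g: "square_integrable g" "v = abs_L2_circle g"
    by (rule L2_circle_cases)
  have *: "(\<i> * a) \<bullet> b = - (a \<bullet> (\<i> * b))" for a b :: complex
    by (simp add: inner_complex_def)
  show ?thesis
    using 1 g by (simp add: scaleC_L2.abs_eq inner_L2_circle.abs_eq L2_rel_refl square_integrable_cmul *)
qed

lemma cinner_L2_scaleC: "cinner_L2 (scaleC_L2 c u) v = c * cinner_L2 u v"
proof -
  have "scaleC_L2 c u = Re c *\<^sub>R u + Im c *\<^sub>R scaleC_L2 \<i> u"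
    using scaleC_L2_simps(1)[of "Re c *\<^sub>R 1" "Im c *\<^sub>R \<i>" u]
    by (simp add: scaleC_L2_simps(4,6)) (metis complex_eq scaleR_conv_of_real mult.commute mult.right_neutral)
  moreover have "scaleC_L2 \<i> u \<bullet> scaleC_L2 \<i> v = u \<bullet> v"
    using inner_scaleC_L2_i[of u "scaleC_L2 \<i> v"] scaleC_L2_simps(4)[of "-1" 1 v]
    by (simp add: scaleC_L2_simps(3,6))
  ultimately show ?thesis
    by (simp add: cinner_L2_def complex_eq_iff inner_add_left inner_scaleC_L2_i)
qed

lemma bounded_linear_cinner_L2: "bounded_linear (\<lambda>u. cinner_L2 u v)"
proof -
  have "cinner_L2 u v = of_real (u \<bullet> v) + \<i> * of_real (u \<bullet> scaleC_L2 \<i> v)" for u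
    by (simp add: cinner_L2_def complex_eq_iff)
  then show ?thesis
    by (auto intro!: bounded_linear_add bounded_linear_const_mult
        bounded_linear_compose[OF bounded_linear_of_real] bounded_linear_inner_left)
qed

text \<open>Rotating \<open>u\<close> by a phase makes the product real and nonnegative; the
  Cauchy-Schwarz inequality for the real inner product then applies.\<close>

lemma norm_cinner_L2_le: "cmod (cinner_L2 u v) \<le> norm u * norm v"
proof -
  \<comment> \<open>Since \<open>sgn 0 = 0\<close>, the phase may vanish; hence only
    \<open>cmod c \<le> 1\<close> is recorded.\<close>
  define c where "c = cnj (sgn (cinner_L2 u v))"
  have "cmod c \<le> 1" by (simp add: c_def norm_sgn)
  have "of_real (cmod (cinner_L2 u v)) = c * cinner_L2 u v"
    by (simp add: c_def sgn_eq complex_norm_square[symmetric] power2_eq_square mult.commute)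
  then have "cmod (cinner_L2 u v) = Re (cinner_L2 (scaleC_L2 c u) v)"
    by (metis cinner_L2_scaleC Re_complex_of_real)
  also have "\<dots> = scaleC_L2 c u \<bullet> v"
    by (simp add: cinner_L2_def)
  also have "\<dots> \<le> norm (scaleC_L2 c u) * norm v"
    by (rule norm_cauchy_schwarz)
  also have "\<dots> \<le> norm u * norm v"
    using \<open>cmod c \<le> 1\<close> by (auto simp: norm_scaleC_L2 intro!: mult_right_mono mult_left_le_one_le)
  finally show ?thesis .
qed

text \<open>Testing with \<open>v = u\<close> suffices. This converts scalar estimates into norm
  estimates, and with \<open>C = 0\<close> it separates vectors.\<close>

lemma norm_le_of_cinner_L2:
  assumes "\<And>v. cmod (cinner_L2 u v) \<le> C * norm v" "0 \<le> C"
  shows "norm u \<le> C"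
proof (cases "u = 0")
  case False
  have "(norm u)\<^sup>2 = Re (cinner_L2 u u)"
    by (simp add: cinner_L2_def power2_norm_eq_inner)
  also have "\<dots> \<le> C * norm u"
    using complex_Re_le_cmod assms order_trans by blast
  finally show ?thesis
    using False by (simp add: power2_eq_square)
qed (simp add: assms)

text \<open>\<open>f\<close> need not extend to the closed disc, so Cauchy's inequality is used on
  radii \<open>\<rho> < R\<close>, which then tend to \<open>R\<close>.\<close>

lemma Taylor_coeff_bound:
  assumes f: "f holomorphic_on ball 0 R" and R: "0 < R"
    and B: "\<And>z. z \<in> ball 0 R \<Longrightarrow> cmod (f z) \<le> B"
  shows "cmod ((deriv ^^ k) f 0 / fact k) \<le> B / R ^ k"
proof (rule tendsto_lowerbound)
  show "((\<lambda>\<rho>. B / \<rho> ^ k) \<longlongrightarrow> B / R ^ k) (at_left R)"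
    using R by (intro tendsto_intros) auto
  show "\<forall>\<^sub>F \<rho> in at_left R. cmod ((deriv ^^ k) f 0 / fact k) \<le> B / \<rho> ^ k"
    using eventually_at_left_real[OF R]
  proof eventually_elim
    case (elim \<rho>)
    have "cmod ((deriv ^^ k) f 0) \<le> fact k * B / \<rho> ^ k"
    proof (rule Cauchy_inequality)
      show "f holomorphic_on ball 0 \<rho>"
        using elim by (intro holomorphic_on_subset[OF f]) auto
      show "continuous_on (cball 0 \<rho>) f"
        using elim by (intro holomorphic_on_imp_continuous_on holomorphic_on_subset[OF f]) auto
    qed (use elim B in auto)
    then show ?case
      by (simp add: norm_divide field_simps)
  qed
qed simp

text \<open>The velocity of the circle path is \<open>2 * pi * \<i>\<close> times its position,
  which cancels one power in Cauchy's formula. What remains is an ordinary integral over an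
  interval, a form that also makes sense for operators.\<close>

lemma Taylor_coeff_circle_integral:
  assumes f: "f holomorphic_on ball 0 1" and r: "0 < r" "r < 1"
  shows "((\<lambda>t. f (circlepath 0 r t) / circlepath 0 r t ^ k) has_integral (deriv ^^ k) f 0 / fact k) {0..1}"
proof -
  have "((\<lambda>u. f u / (u - 0) ^ Suc k) has_contour_integral ((2 * pi * \<i>) / fact k * (deriv ^^ k) f 0))
      (circlepath 0 r)"
  proof (rule Cauchy_has_contour_integral_higher_derivative_circlepath)
    show "continuous_on (cball 0 r) f"
      using r by (intro holomorphic_on_imp_continuous_on holomorphic_on_subset[OF f]) auto
    show "f holomorphic_on ball 0 r"
      using r by (intro holomorphic_on_subset[OF f]) auto
  qed (use r in auto)
  then have "((\<lambda>t. f (circlepath 0 r t) / circlepath 0 r t ^ Suc k *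
      vector_derivative (circlepath 0 r) (at t)) has_integral
      ((2 * pi * \<i>) / fact k * (deriv ^^ k) f 0)) {0..1}"
    by (simp add: has_contour_integral)
  from has_integral_mult_right[OF this, of "1 / (2 * pi * \<i>)"]
  have "((\<lambda>t. 1 / (2 * pi * \<i>) * (f (circlepath 0 r t) / circlepath 0 r t ^ Suc k *
      vector_derivative (circlepath 0 r) (at t))) has_integral (deriv ^^ k) f 0 / fact k) {0..1}"
    by simp
  moreover have "1 / (2 * pi * \<i>) * (f (circlepath 0 r t) / circlepath 0 r t ^ Suc k *
      vector_derivative (circlepath 0 r) (at t)) = f (circlepath 0 r t) / circlepath 0 r t ^ k" for t
  proof -
    have vd: "vector_derivative (circlepath 0 r) (at t) = 2 * pi * \<i> * circlepath 0 r t"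
      by (simp add: vector_derivative_circlepath) (simp add: circlepath)
    have "circlepath 0 r t \<noteq> 0"
      using r by (simp add: circlepath)
    then show ?thesis by (simp add: vd)
  qed
  ultimately show ?thesis by simp
qed

text \<open>
  The Taylor coefficients are operator-valued circle integrals; they are identified, and the series
  is summed, by testing against \<^term>\<open>\<lambda>A. cinner_L2 (blinfun_apply A g) h\<close>.
\<close>

lemma op_holomorphic_eq_series:
  assumes f: "f op_holomorphic_on ball 0 1"
    and bound: "\<And>z. cmod z < 1 \<Longrightarrow> norm (f z) \<le> 1"
  obtains A where "\<And>k. norm (A k) \<le> 1" "\<And>z. cmod z < 1 \<Longrightarrow> f z = op_series A z"
proof -
  define \<phi> where "\<phi> g h = (\<lambda>z. cinner_L2 (blinfun_apply (f z) g) h)" for g h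
  have blin: "bounded_linear (\<lambda>A. cinner_L2 (blinfun_apply A g) h)" for g h
    by (rule bounded_linear_compose[OF bounded_linear_cinner_L2 blinfun.bounded_linear_left])
  have cscale: "cinner_L2 (blinfun_apply (scaleC_op c A) g) h = c * cinner_L2 (blinfun_apply A g) h"
    for c A g h
    by (simp add: scaleC_op_apply cinner_L2_scaleC)
  have deriv: "\<exists>D. (f has_derivative (\<lambda>c. scaleC_op c D)) (at z)" if "cmod z < 1" for z
    using f that unfolding op_holomorphic_on_def has_op_derivative_def
    by (metis at_within_open mem_ball_0 open_ball)
  have hol: "\<phi> g h holomorphic_on ball 0 1" for g h
    unfolding holomorphic_on_open[OF open_ball]
  proof safe
    fix z :: complex assume "z \<in> ball 0 1"
    then obtain D where "(f has_derivative (\<lambda>c. scaleC_op c D)) (at z)"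
      using deriv by auto
    from bounded_linear.has_derivative[OF blin this]
    have "(\<phi> g h has_derivative (\<lambda>c. c * cinner_L2 (blinfun_apply D g) h)) (at z)"
      by (simp add: cscale \<phi>_def)
    then show "\<exists>d. (\<phi> g h has_field_derivative d) (at z)"
      by (auto simp: has_field_derivative_def mult_commute_abs)
  qed
  have weak: "cmod (cinner_L2 (blinfun_apply A g) h) \<le> norm A * norm g * norm h" for A g h
    using order_trans[OF norm_cinner_L2_le mult_right_mono[OF norm_blinfun norm_ge_zero]] .
  have \<phi>_bound: "cmod (\<phi> g h z) \<le> norm g * norm h" if "z \<in> ball 0 1" for g h z
  proof -
    have "cmod (\<phi> g h z) \<le> norm (f z) * norm g * norm h"
      unfolding \<phi>_def by (rule weak)
    also have "\<dots> \<le> 1 * norm g * norm h"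
      using bound[of z] that by (intro mult_right_mono) auto
    finally show ?thesis by simp
  qed
  \<comment> \<open>Any radius strictly between 0 and 1 would do; the Taylor coefficients do not
    depend on it.\<close>
  define \<gamma> where "\<gamma> = circlepath 0 (1/2 :: real)"
  have \<gamma>: "cmod (\<gamma> t) = 1/2" for t
    by (simp add: \<gamma>_def circlepath norm_mult)
  then have \<gamma>0: "\<gamma> t \<noteq> 0" for t
    by (metis norm_zero zero_neq_numeral divide_eq_0_iff one_neq_zero)
  define A where "A k = integral {0..1} (\<lambda>t. scaleC_op (1 / \<gamma> t ^ k) (f (\<gamma> t)))" for k
  have cont: "continuous_on (ball 0 1) f"
    using deriv by (intro continuous_at_imp_continuous_on ballI) 
      (auto dest: has_derivative_continuous)
  have cont\<gamma>: "continuous_on {0..1} \<gamma>"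
    unfolding \<gamma>_def circlepath by (intro continuous_intros)
  have int: "((\<lambda>t. scaleC_op (1 / \<gamma> t ^ k) (f (\<gamma> t))) has_integral A k) {0..1}" for k
    unfolding A_def
  proof (rule integrable_integral[OF integrable_continuous_interval])
    show "continuous_on {0..1} (\<lambda>t. scaleC_op (1 / \<gamma> t ^ k) (f (\<gamma> t)))"
      by (intro bounded_bilinear.continuous_on[OF bounded_bilinear_scaleC_op] continuous_intros
          cont\<gamma> continuous_on_compose2[OF cont cont\<gamma>])
        (auto simp: \<gamma> \<gamma>0)
  qed
  have coeff: "cinner_L2 (blinfun_apply (A k) g) h = (deriv ^^ k) (\<phi> g h) 0 / fact k" for k g h
  proof (rule has_integral_unique)
    show "((\<lambda>t. \<phi> g h (\<gamma> t) / \<gamma> t ^ k) has_integral cinner_L2 (blinfun_apply (A k) g) h) {0..1}"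
      using has_integral_linear[OF int blin] by (simp add: o_def cscale \<phi>_def)
    show "((\<lambda>t. \<phi> g h (\<gamma> t) / \<gamma> t ^ k) has_integral (deriv ^^ k) (\<phi> g h) 0 / fact k) {0..1}"
      unfolding \<gamma>_def by (rule Taylor_coeff_circle_integral[OF hol]) auto
  qed
  \<comment> \<open>Estimating the integral at radius 1/2 directly would only give
    \<open>2 ^ k\<close>. The scalar Taylor coefficients are bounded with the full radius 1, and the
    bound is transferred back by duality.\<close>
  have A_le: "norm (A k) \<le> 1" for k
  proof (rule norm_blinfun_bound)
    fix g
    show "norm (A k g) \<le> 1 * norm g"
    proof (rule norm_le_of_cinner_L2)
      show "cmod (cinner_L2 (A k g) h) \<le> 1 * norm g * norm h" for h
        using Taylor_coeff_bound[OF hol zero_less_one \<phi>_bound, of k g h] by (simp add: coeff)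
    qed auto
  qed simp
  have summ: "summable_coeffs A"
    by (rule summable_coeffs_bounded[OF A_le])
  have "f z = op_series A z" if z: "cmod z < 1" for z
  proof (rule blinfun_eqI)
    fix g
    have "cinner_L2 (f z g) h = cinner_L2 (op_series A z g) h" for h
    proof (rule sums_unique2)
      show "(\<lambda>k. (deriv ^^ k) (\<phi> g h) 0 / fact k * z ^ k) sums cinner_L2 (f z g) h"
        using holomorphic_power_series[OF hol[of g h], of z] z by (simp add: \<phi>_def)
      show "(\<lambda>k. (deriv ^^ k) (\<phi> g h) 0 / fact k * z ^ k) sums cinner_L2 (op_series A z g) h"
        using bounded_linear.sums[OF blin op_series_sums[OF summ z], of g h]
        by (simp add: cscale coeff mult.commute)
    qed
    then have "cinner_L2 (f z g - op_series A z g) h = 0" for h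
      by (simp add: bounded_linear.linear[OF bounded_linear_cinner_L2] linear_diff[of "\<lambda>u. cinner_L2 u h"])
    then have "norm (f z g - op_series A z g) \<le> 0"
      by (intro norm_le_of_cinner_L2) auto
    then show "f z g = op_series A z g" by simp
  qed
  with A_le show ?thesis by (rule that)
qed

section \<open>Holomorphic functions on the bidisc\<close>

lemma sums_tail_bound:
  fixes a :: "nat \<Rightarrow> 'a :: banach"
  assumes s: "a sums s" and a: "\<And>k. norm (a k) \<le> x ^ k" and x: "0 \<le> x" "x < 1"
  shows "norm (s - (\<Sum>k<n. a k)) \<le> x ^ n / (1 - x)"
proof -
  have "(\<lambda>i. a (i + n)) sums (s - (\<Sum>k<n. a k))"
    using s by (rule sums_split_initial_segment)
  moreover have g: "(\<lambda>i. x ^ n * x ^ i) sums (x ^ n * (1 / (1 - x)))"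
    using x by (intro sums_mult geometric_sums) auto
  moreover have "norm (a (i + n)) \<le> x ^ n * x ^ i" for i
    using a[of "i + n"] by (simp add: power_add mult.commute)
  ultimately have "norm (s - (\<Sum>k<n. a k)) \<le> (\<Sum>i. x ^ n * x ^ i)"
    by (metis norm_suminf_le sums_unique sums_summable)
  then show ?thesis
    using sums_unique[OF g] by simp
qed

lemma holomorphic2_onD:
  assumes "F holomorphic2_on bidisc" "cmod z1 < 1" "cmod z2 < 1"
  obtains a b where "(F has_derivative (\<lambda>h. a * fst h + b * snd h)) (at (z1, z2))"
proof -
  have o: "open bidisc" and z: "(z1, z2) \<in> bidisc"
    using assms by (simp_all add: bidisc_def open_Times)
  from assms(1) z have "\<exists>a b. (F has_derivative (\<lambda>h. a * fst h + b * snd h)) (at (z1, z2) within bidisc)"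
    unfolding holomorphic2_on_def by (rule bspec)
  then show ?thesis
    unfolding at_within_open[OF z o] using that by blast
qed

lemma holomorphic2_onI:
  assumes "\<And>z1 z2. cmod z1 < 1 \<Longrightarrow> cmod z2 < 1 \<Longrightarrow>
    \<exists>a b. (F has_derivative (\<lambda>h. a * fst h + b * snd h)) (at (z1, z2))"
  shows "F holomorphic2_on bidisc"
  unfolding holomorphic2_on_def bidisc_def
proof
  fix z :: "complex \<times> complex" assume "z \<in> ball 0 1 \<times> ball 0 1"
  then have "\<exists>a b. (F has_derivative (\<lambda>h. a * fst h + b * snd h)) (at z)"
    using assms[of "fst z" "snd z"] by auto
  then show "\<exists>a b. (F has_derivative (\<lambda>h. a * fst h + b * snd h)) (at z within ball 0 1 \<times> ball 0 1)"
    using has_derivative_at_withinI by blast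
qed

text \<open>By the chain rule the restricted derivative is multiplication by
  \<open>\<alpha> * b + \<beta> * d\<close>. The affine form covers the coordinate slices and the
  maps to \<open>(l, l * \<zeta>)\<close>, with either \<open>l\<close> or \<open>\<zeta>\<close> as
  the variable.\<close>

lemma holomorphic2_on_line:
  assumes F: "F holomorphic2_on bidisc" and "open S"
    and S: "\<And>w. w \<in> S \<Longrightarrow> cmod (a + b * w) < 1 \<and> cmod (c + d * w) < 1"
  shows "(\<lambda>w. F (a + b * w, c + d * w)) holomorphic_on S"
  unfolding holomorphic_on_open[OF \<open>open S\<close>]
proof
  fix w assume "w \<in> S"
  then obtain \<alpha> \<beta> where
    "(F has_derivative (\<lambda>h. \<alpha> * fst h + \<beta> * snd h)) (at (a + b * w, c + d * w))"
    using holomorphic2_onD[OF F] S by metis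
  moreover have "((\<lambda>w. (a + b * w, c + d * w)) has_derivative (\<lambda>h. (b * h, d * h))) (at w)"
    by (auto intro!: derivative_eq_intros)
  ultimately have "(F \<circ> (\<lambda>w. (a + b * w, c + d * w)) has_derivative
      (\<lambda>h. \<alpha> * fst h + \<beta> * snd h) \<circ> (\<lambda>h. (b * h, d * h))) (at w)"
    by (intro diff_chain_at)
  moreover have "(\<lambda>h. \<alpha> * fst h + \<beta> * snd h) \<circ> (\<lambda>h. (b * h, d * h)) = (*) (\<alpha> * b + \<beta> * d)"
    by (auto simp: fun_eq_iff algebra_simps)
  ultimately show "\<exists>f'. ((\<lambda>w. F (a + b * w, c + d * w)) has_field_derivative f') (at w)"
    by (auto simp: has_field_derivative_def o_def)
qed

lemma holomorphic2_on_slices: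
  assumes "F holomorphic2_on bidisc"
  shows "cmod z2 < 1 \<Longrightarrow> (\<lambda>w. F (w, z2)) holomorphic_on ball 0 1"
    and "cmod z1 < 1 \<Longrightarrow> (\<lambda>w. F (z1, w)) holomorphic_on ball 0 1"
  using holomorphic2_on_line[OF assms open_ball, of 0 1 0 1 z2 0]
    holomorphic2_on_line[OF assms open_ball, of 0 1 z1 0 0 1] by simp_all

section \<open>Closure properties and partial derivatives of holomorphic functions of two
  variables\<close>

lemma holomorphic2_on_const: "(\<lambda>z. c) holomorphic2_on S"
  unfolding holomorphic2_on_def
  by (rule ballI, rule exI[of _ 0], rule exI[of _ 0]) simp

lemma holomorphic2_on_fst: "fst holomorphic2_on S"
  unfolding holomorphic2_on_def
  by (rule ballI, rule exI[of _ 1], rule exI[of _ 0]) (simp add: bounded_linear_fst bounded_linear_imp_has_derivative)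

lemma holomorphic2_on_snd: "snd holomorphic2_on S"
  unfolding holomorphic2_on_def
  by (rule ballI, rule exI[of _ 0], rule exI[of _ 1]) (simp add: bounded_linear_snd bounded_linear_imp_has_derivative)

lemma holomorphic2_on_add:
  assumes "F holomorphic2_on S" "G holomorphic2_on S"
  shows "(\<lambda>z. F z + G z) holomorphic2_on S"
  unfolding holomorphic2_on_def
proof
  fix z assume "z \<in> S"
  note ex = assms[unfolded holomorphic2_on_def, THEN bspec, OF this]
  obtain a b where F: "(F has_derivative (\<lambda>h. a * fst h + b * snd h)) (at z within S)"
    using ex(1) by blast
  obtain c d where G: "(G has_derivative (\<lambda>h. c * fst h + d * snd h)) (at z within S)"
    using ex(2) by blast
  from has_derivative_add[OF F G]
  have "((\<lambda>z. F z + G z) has_derivative (\<lambda>h. (a + c) * fst h + (b + d) * snd h)) (at z within S)"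
    by (simp add: algebra_simps)
  then show "\<exists>a b. ((\<lambda>z. F z + G z) has_derivative (\<lambda>h. a * fst h + b * snd h)) (at z within S)"
    by blast
qed

lemma holomorphic2_on_mult:
  assumes "F holomorphic2_on S" "G holomorphic2_on S"
  shows "(\<lambda>z. F z * G z) holomorphic2_on S"
  unfolding holomorphic2_on_def
proof
  fix z assume "z \<in> S"
  note ex = assms[unfolded holomorphic2_on_def, THEN bspec, OF this]
  obtain a b where F: "(F has_derivative (\<lambda>h. a * fst h + b * snd h)) (at z within S)"
    using ex(1) by blast
  obtain c d where G: "(G has_derivative (\<lambda>h. c * fst h + d * snd h)) (at z within S)"
    using ex(2) by blast
  from has_derivative_mult[OF F G]
  have "((\<lambda>z. F z * G z) has_derivative
      (\<lambda>h. (F z * c + a * G z) * fst h + (F z * d + b * G z) * snd h)) (at z within S)"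
    by (simp add: algebra_simps)
  then show "\<exists>a b. ((\<lambda>z. F z * G z) has_derivative (\<lambda>h. a * fst h + b * snd h)) (at z within S)"
    by blast
qed

lemma holomorphic2_on_power:
  "F holomorphic2_on S \<Longrightarrow> (\<lambda>z. F z ^ n) holomorphic2_on S"
  by (induction n) (auto intro: holomorphic2_on_const holomorphic2_on_mult)

lemma holomorphic2_on_sum:
  "(\<And>i. i \<in> I \<Longrightarrow> F i holomorphic2_on S) \<Longrightarrow> (\<lambda>z. \<Sum>i\<in>I. F i z) holomorphic2_on S"
  by (induction I rule: infinite_finite_induct)
    (auto intro: holomorphic2_on_const holomorphic2_on_add)

lemma holomorphic2_on_diff:
  assumes "F holomorphic2_on S" "G holomorphic2_on S"
  shows "(\<lambda>z. F z - G z) holomorphic2_on S"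
  using holomorphic2_on_add[OF assms(1) holomorphic2_on_mult[OF holomorphic2_on_const[of "-1"] assms(2)]]
  by simp

lemma norm_pderiv1_le:
  assumes F: "F holomorphic2_on bidisc" and r: "0 < s" "cmod z1 + s < 1" "cmod z2 < 1"
    and B: "\<And>w. cmod (w - z1) \<le> s \<Longrightarrow> cmod (F (w, z2)) \<le> B"
  shows "cmod (deriv (\<lambda>w. F (w, z2)) z1) \<le> B / s"
proof -
  have sub: "cball z1 s \<subseteq> ball 0 1"
  proof
    fix w assume "w \<in> cball z1 s"
    then show "w \<in> ball 0 1"
      using r norm_triangle_sub[of w z1] by (auto simp: dist_norm norm_minus_commute)
  qed
  have hol: "(\<lambda>w. F (w, z2)) holomorphic_on cball z1 s"
    by (rule holomorphic_on_subset[OF holomorphic2_on_slices(1)[OF F r(3)] sub])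
  have "cmod ((deriv ^^ 1) (\<lambda>w. F (w, z2)) z1) \<le> fact 1 * B / s ^ 1"
    by (rule Cauchy_inequality[OF holomorphic_on_subset[OF hol ball_subset_cball]
          holomorphic_on_imp_continuous_on[OF hol] r(1)])
      (auto intro!: B simp: norm_minus_commute)
  then show ?thesis by simp
qed

text \<open>Carries estimates for the first partial derivative over to the second.\<close>

lemma holomorphic2_on_swap:
  assumes "F holomorphic2_on bidisc"
  shows "(\<lambda>z. F (snd z, fst z)) holomorphic2_on bidisc"
proof (rule holomorphic2_onI)
  fix z1 z2 :: complex assume z: "cmod z1 < 1" "cmod z2 < 1"
  obtain a b where *: "(F has_derivative (\<lambda>h. a * fst h + b * snd h)) (at (z2, z1))"
    using holomorphic2_onD[OF assms z(2,1)] by blast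
  have **: "((\<lambda>z. (snd z, fst z)) has_derivative (\<lambda>h. (snd h, fst h))) (at (z1, z2))"
    by (auto intro!: derivative_eq_intros)
  have "(F \<circ> (\<lambda>z. (snd z, fst z)) has_derivative
      (\<lambda>h. a * fst h + b * snd h) \<circ> (\<lambda>h. (snd h, fst h))) (at (z1, z2))"
    by (rule diff_chain_at[OF **]) (simp add: *)
  then have "((\<lambda>z. F (snd z, fst z)) has_derivative (\<lambda>h. b * fst h + a * snd h)) (at (z1, z2))"
    by (simp add: o_def add.commute)
  then show "\<exists>a b. ((\<lambda>z. F (snd z, fst z)) has_derivative (\<lambda>h. a * fst h + b * snd h)) (at (z1, z2))"
    by blast
qed

lemma norm_pderiv2_le:
  assumes F: "F holomorphic2_on bidisc" and r: "0 < s" "cmod z2 + s < 1" "cmod z1 < 1"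
    and B: "\<And>w. cmod (w - z2) \<le> s \<Longrightarrow> cmod (F (z1, w)) \<le> B"
  shows "cmod (deriv (\<lambda>w. F (z1, w)) z2) \<le> B / s"
  using norm_pderiv1_le[OF holomorphic2_on_swap[OF F] r] B by simp

text \<open>Identifies the existentially given coefficients with slice derivatives, which Cauchy's
  estimates can bound.\<close>

lemma has_derivative_holomorphic2:
  assumes F: "F holomorphic2_on bidisc" and z: "cmod z1 < 1" "cmod z2 < 1"
  shows "(F has_derivative (\<lambda>h. deriv (\<lambda>w. F (w, z2)) z1 * fst h + deriv (\<lambda>w. F (z1, w)) z2 * snd h))
    (at (z1, z2))"
proof -
  obtain a b where *: "(F has_derivative (\<lambda>h. a * fst h + b * snd h)) (at (z1, z2))"
    using holomorphic2_onD[OF F z] by blast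
  have 1: "((\<lambda>w. (w, z2)) has_derivative (\<lambda>h. (h, 0))) (at z1)"
    by (auto intro!: derivative_eq_intros)
  have 2: "((\<lambda>w. (z1, w)) has_derivative (\<lambda>h. (0, h))) (at z2)"
    by (auto intro!: derivative_eq_intros)
  have "((\<lambda>w. F (w, z2)) has_field_derivative a) (at z1)"
    using diff_chain_at[OF 1 *] by (simp add: o_def has_field_derivative_def mult_commute_abs)
  moreover have "((\<lambda>w. F (z1, w)) has_field_derivative b) (at z2)"
    using diff_chain_at[OF 2 *] by (simp add: o_def has_field_derivative_def mult_commute_abs)
  ultimately show ?thesis
    using * by (simp add: DERIV_imp_deriv)
qed

text \<open>The maximum principle is used twice: in the first variable with the second on the
  circle, then in the second variable with the first one fixed.\<close>

lemma polydisc_maximum_modulus: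
  assumes 1: "\<And>z2. cmod z2 \<le> r \<Longrightarrow> (\<lambda>z1. F z1 z2) holomorphic_on cball 0 r"
    and 2: "\<And>z1. cmod z1 \<le> r \<Longrightarrow> (\<lambda>z2. F z1 z2) holomorphic_on cball 0 r"
    and B: "\<And>z1 z2. cmod z1 = r \<Longrightarrow> cmod z2 = r \<Longrightarrow> cmod (F z1 z2) \<le> B"
    and r: "0 < r" and z: "cmod z1 \<le> r" "cmod z2 \<le> r"
  shows "cmod (F z1 z2) \<le> B"
proof -
  have max: "cmod (g w) \<le> B" if g: "g holomorphic_on cball 0 r"
    "\<And>w. cmod w = r \<Longrightarrow> cmod (g w) \<le> B" "cmod w \<le> r" for g w
  proof (rule maximum_modulus_frontier[where f = g and \<xi> = w and S = "cball 0 r"])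
    show "g holomorphic_on interior (cball 0 r)"
      by (rule holomorphic_on_subset[OF g(1) interior_subset])
    show "continuous_on (closure (cball 0 r)) g"
      using holomorphic_on_imp_continuous_on[OF g(1)] by simp
  qed (use r g in auto)
  have "cmod (F z1 w) \<le> B" if "cmod w = r" for w
  proof (rule max[of "\<lambda>z1. F z1 w"])
    show "(\<lambda>z1. F z1 w) holomorphic_on cball 0 r" using that by (intro 1) simp
  qed (use that z B in auto)
  then show ?thesis
    by (rule max[OF 2[OF z(1)] _ z(2)])
qed

text \<open>The Weierstrass convergence theorem: Cauchy's estimates turn a summable bound on the
  terms into one on their partial derivatives over a smaller polydisc, so the series may be
  differentiated termwise.\<close>

lemma holomorphic2_series:
  assumes f: "\<And>n. f n holomorphic2_on bidisc"
    and M: "\<And>r. 0 < r \<Longrightarrow> r < 1 \<Longrightarrow> \<exists>M. summable M \<and>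
      (\<forall>n z1 z2. cmod z1 \<le> r \<longrightarrow> cmod z2 \<le> r \<longrightarrow> cmod (f n (z1, z2)) \<le> M n)"
  shows "(\<lambda>z. \<Sum>n. f n z) holomorphic2_on bidisc"
proof (rule holomorphic2_onI)
  fix u1 u2 :: complex assume u: "cmod u1 < 1" "cmod u2 < 1"
  obtain r where r: "max (cmod u1) (cmod u2) < r" "r < 1"
    using u dense[of "max (cmod u1) (cmod u2)" 1] by auto
  then have r0: "0 < r" using norm_ge_zero[of u1] by linarith
  \<comment> \<open>The margin \<open>R - r\<close> is the radius of the Cauchy estimates at points
    of the smaller polydisc.\<close>
  obtain R where R: "r < R" "R < 1" using r dense by blast
  obtain M where M: "summable M"
    and fM: "\<And>n z1 z2. cmod z1 \<le> R \<Longrightarrow> cmod z2 \<le> R \<Longrightarrow> cmod (f n (z1, z2)) \<le> M n"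
    using M[of R] R r0 by auto
  let ?S = "ball 0 r \<times> ball 0 r :: (complex \<times> complex) set"
  define a where "a n z = deriv (\<lambda>w. f n (w, snd z)) (fst z)" for n z
  define b where "b n z = deriv (\<lambda>w. f n (fst z, w)) (snd z)" for n z
  have near: "cmod w \<le> R" if "cmod (w - v) \<le> R - r" "cmod v < r" for w v
    using norm_triangle_sub[of w v] that by linarith
  have ab: "cmod (a n z) \<le> M n / (R - r)" "cmod (b n z) \<le> M n / (R - r)" if "z \<in> ?S" for n z
  proof -
    have z: "cmod (fst z) < r" "cmod (snd z) < r" using that by auto
    show "cmod (a n z) \<le> M n / (R - r)"
      unfolding a_def using z R
      by (intro norm_pderiv1_le[OF f]) (auto intro!: fM dest: near[OF _ z(1)])
    show "cmod (b n z) \<le> M n / (R - r)"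
      unfolding b_def using z R
      by (intro norm_pderiv2_le[OF f]) (auto intro!: fM dest: near[OF _ z(2)])
  qed
  have M': "summable (\<lambda>n. M n / (R - r))"
    by (rule summable_divide[OF M])
  have ula: "uniform_limit ?S (\<lambda>n z. \<Sum>i<n. a i z) (\<lambda>z. \<Sum>i. a i z) sequentially"
    by (rule Weierstrass_m_test[OF ab(1) M'])
  have ulb: "uniform_limit ?S (\<lambda>n z. \<Sum>i<n. b i z) (\<lambda>z. \<Sum>i. b i z) sequentially"
    by (rule Weierstrass_m_test[OF ab(2) M'])
  have der: "(f n has_derivative (\<lambda>h. a n z * fst h + b n z * snd h)) (at z within ?S)"
    if "z \<in> ?S" for n z
  proof (rule has_derivative_at_withinI)
    have "cmod (fst z) < 1" "cmod (snd z) < 1" using that r by auto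
    from has_derivative_holomorphic2[OF f this]
    show "(f n has_derivative (\<lambda>h. a n z * fst h + b n z * snd h)) (at z)"
      by (simp add: a_def b_def)
  qed
  have unif: "\<forall>\<^sub>F n in sequentially. \<forall>z\<in>?S. \<forall>h. norm ((\<Sum>i<n. a i z * fst h + b i z * snd h)
        - ((\<Sum>i. a i z) * fst h + (\<Sum>i. b i z) * snd h)) \<le> e * norm h" if "e > 0" for e
  proof -
    note \<open>e > 0\<close>
    then have "\<forall>\<^sub>F n in sequentially. \<forall>z\<in>?S. dist (\<Sum>i<n. a i z) (\<Sum>i. a i z) < e / 2"
      "\<forall>\<^sub>F n in sequentially. \<forall>z\<in>?S. dist (\<Sum>i<n. b i z) (\<Sum>i. b i z) < e / 2"
      using ula ulb half_gt_zero[of e] unfolding uniform_limit_iff by blast+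
    then show "\<forall>\<^sub>F n in sequentially. \<forall>z\<in>?S. \<forall>h. norm ((\<Sum>i<n. a i z * fst h + b i z * snd h)
        - ((\<Sum>i. a i z) * fst h + (\<Sum>i. b i z) * snd h)) \<le> e * norm h"
    proof eventually_elim
      case (elim n)
      show ?case
      proof (intro ballI allI)
        fix z h assume z: "z \<in> ?S"
        have "(\<Sum>i<n. a i z * fst h + b i z * snd h) - ((\<Sum>i. a i z) * fst h + (\<Sum>i. b i z) * snd h)
            = ((\<Sum>i<n. a i z) - (\<Sum>i. a i z)) * fst h + ((\<Sum>i<n. b i z) - (\<Sum>i. b i z)) * snd h"
          by (simp add: sum.distrib sum_distrib_right[symmetric]) (simp add: algebra_simps)
        also have "norm \<dots> \<le> e / 2 * norm h + e / 2 * norm h"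
        proof (rule order_trans[OF norm_triangle_ineq add_mono])
          have "norm (fst h) \<le> norm h" "norm (snd h) \<le> norm h"
            using norm_fst_le[of "fst h" "snd h"] norm_snd_le[of "snd h" "fst h"] by simp_all
          moreover have "dist (\<Sum>i<n. a i z) (\<Sum>i. a i z) \<le> e / 2"
            "dist (\<Sum>i<n. b i z) (\<Sum>i. b i z) \<le> e / 2"
            using elim z by (meson less_imp_le)+
          ultimately show "norm (((\<Sum>i<n. a i z) - (\<Sum>i. a i z)) * fst h) \<le> e / 2 * norm h"
            "norm (((\<Sum>i<n. b i z) - (\<Sum>i. b i z)) * snd h) \<le> e / 2 * norm h"
            using \<open>e > 0\<close> unfolding norm_mult dist_norm by (intro mult_mono; simp)+
        qed
        finally show "norm ((\<Sum>i<n. a i z * fst h + b i z * snd h)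
            - ((\<Sum>i. a i z) * fst h + (\<Sum>i. b i z) * snd h)) \<le> e * norm h"
          by simp
      qed
    qed
  qed
  have "summable (\<lambda>n. f n (0, 0))"
    by (rule summable_comparison_test'[OF M]) (use fM r0 R in auto)
  then have sums0: "(\<lambda>n. f n (0, 0)) sums (\<Sum>n. f n (0, 0))" by (rule summable_sums)
  have "(0, 0) \<in> ?S" using r0 by simp
  have "\<exists>g. \<forall>z\<in>?S. (\<lambda>n. f n z) sums (g z) \<and>
      (g has_derivative (\<lambda>h. (\<Sum>i. a i z) * fst h + (\<Sum>i. b i z) * snd h)) (at z within ?S)"
    by (rule has_derivative_series[where S = ?S and f = f and x = "(0, 0)"
          and f' = "\<lambda>n z h. a n z * fst h + b n z * snd h"])
      (rule convex_Times[OF convex_ball convex_ball], rule der, assumption, rule unif, assumption,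
        rule \<open>(0, 0) \<in> ?S\<close>, rule sums0)
  then obtain g where g: "\<And>z. z \<in> ?S \<Longrightarrow> (\<lambda>n. f n z) sums (g z)"
    and g': "\<And>z. z \<in> ?S \<Longrightarrow> (g has_derivative
      (\<lambda>h. (\<Sum>i. a i z) * fst h + (\<Sum>i. b i z) * snd h)) (at z within ?S)"
    by blast
  let ?u = "(u1, u2)"
  have u: "?u \<in> ?S" using r by auto
  have S: "open ?S" by (intro open_Times open_ball)
  have "(g has_derivative (\<lambda>h. (\<Sum>i. a i ?u) * fst h + (\<Sum>i. b i ?u) * snd h)) (at ?u)"
    using g'[OF u] by (simp add: at_within_open[OF u S])
  then have "((\<lambda>z. \<Sum>n. f n z) has_derivative
      (\<lambda>h. (\<Sum>i. a i ?u) * fst h + (\<Sum>i. b i ?u) * snd h)) (at ?u)"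
    by (rule has_derivative_transform_within_open[OF _ S u]) (use g in \<open>auto dest: sums_unique\<close>)
  then show "\<exists>a b. ((\<lambda>z. \<Sum>n. f n z) has_derivative (\<lambda>h. a * fst h + b * snd h)) (at ?u)"
    by blast
qed

section \<open>Homogeneous polynomials and their series\<close>

text \<open>The homogenisation \<open>z\<^sub>1\<^sup>k P(z\<^sub>2 / z\<^sub>1)\<close>; it is meaningful for \<open>degree P \<le> k\<close>.\<close>

definition hom_poly :: "nat \<Rightarrow> complex poly \<Rightarrow> complex \<Rightarrow> complex \<Rightarrow> complex" where
  "hom_poly k P z1 z2 = (\<Sum>j\<le>k. coeff P j * z1 ^ (k - j) * z2 ^ j)"

lemma hom_poly_eq:
  assumes "degree P \<le> k"
  shows "hom_poly k P l (l * \<zeta>) = l ^ k * poly P \<zeta>"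
proof -
  have "poly P \<zeta> = (\<Sum>j\<le>k. coeff P j * \<zeta> ^ j)"
    unfolding poly_altdef using assms
    by (intro sum.mono_neutral_left) (auto simp: coeff_eq_0)
  moreover have "hom_poly k P l (l * \<zeta>) = (\<Sum>j\<le>k. l ^ k * (coeff P j * \<zeta> ^ j))"
    unfolding hom_poly_def
  proof (rule sum.cong[OF refl])
    fix j assume "j \<in> {..k}"
    then have "l ^ k = l ^ (k - j) * l ^ j" by (simp flip: power_add)
    then show "coeff P j * l ^ (k - j) * (l * \<zeta>) ^ j = l ^ k * (coeff P j * \<zeta> ^ j)"
      by (simp add: power_mult_distrib)
  qed
  ultimately show ?thesis
    by (simp add: sum_distrib_left)
qed

lemma hom_poly_holomorphic:
  "(\<lambda>z1. hom_poly k P z1 z2) holomorphic_on S" "(\<lambda>z2. hom_poly k P z1 z2) holomorphic_on S"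
  unfolding hom_poly_def by (intro holomorphic_intros)+

lemma hom_poly_holomorphic2: "(\<lambda>z. hom_poly k P (fst z) (snd z)) holomorphic2_on S"
  unfolding hom_poly_def
  by (intro holomorphic2_on_sum holomorphic2_on_mult holomorphic2_on_power
      holomorphic2_on_const holomorphic2_on_fst holomorphic2_on_snd)

text \<open>On the torus of radius \<open>r\<close> the quotient \<open>z2 / z1\<close> is
  unimodular, so the bound for \<open>P\<close> on the circle applies there; the maximum principle
  carries it inside.\<close>

lemma norm_hom_poly_le:
  assumes deg: "degree P \<le> k" and P: "\<And>\<zeta>. cmod \<zeta> = 1 \<Longrightarrow> cmod (poly P \<zeta>) \<le> 1"
    and r: "0 < r" "cmod z1 \<le> r" "cmod z2 \<le> r"
  shows "cmod (hom_poly k P z1 z2) \<le> r ^ k"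
proof (rule polydisc_maximum_modulus[where r = r and F = "hom_poly k P"])
  fix z1 z2 :: complex assume z: "cmod z1 = r" "cmod z2 = r"
  then have "z1 \<noteq> 0" using r(1) by auto
  then have "hom_poly k P z1 z2 = z1 ^ k * poly P (z2 / z1)"
    using hom_poly_eq[OF deg, of z1 "z2 / z1"] by simp
  moreover have "cmod (poly P (z2 / z1)) \<le> 1"
    using z r(1) by (intro P) (simp add: norm_divide)
  ultimately show "cmod (hom_poly k P z1 z2) \<le> r ^ k"
    using z r(1) by (simp add: norm_mult norm_power mult_left_le)
qed (use r in \<open>auto intro: hom_poly_holomorphic\<close>)

lemma hom_poly_series_sums:
  assumes deg: "\<And>k. degree (P k) \<le> k"
    and P: "\<And>k \<zeta>. cmod \<zeta> = 1 \<Longrightarrow> cmod (poly (P k) \<zeta>) \<le> 1"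
    and r: "cmod z1 < 1" "cmod z2 < 1"
  shows "(\<lambda>k. hom_poly k (P k) z1 z2) sums (\<Sum>k. hom_poly k (P k) z1 z2)"
proof -
  obtain r where r: "max (cmod z1) (cmod z2) < r" "r < 1"
    using r dense[of "max (cmod z1) (cmod z2)" 1] by auto
  then have r0: "0 < r" using norm_ge_zero[of z1] by linarith
  have "summable (\<lambda>k. r ^ k)"
    using r r0 by (intro summable_geometric) auto
  then have "summable (\<lambda>k. hom_poly k (P k) z1 z2)"
    by (rule summable_comparison_test')
      (use norm_hom_poly_le[OF deg P r0] r in auto)
  then show ?thesis by (rule summable_sums)
qed

lemma hom_poly_series_holomorphic2:
  assumes deg: "\<And>k. degree (P k) \<le> k"
    and P: "\<And>k \<zeta>. cmod \<zeta> = 1 \<Longrightarrow> cmod (poly (P k) \<zeta>) \<le> 1"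
  shows "(\<lambda>z. \<Sum>k. hom_poly k (P k) (fst z) (snd z)) holomorphic2_on bidisc"
proof (rule holomorphic2_series[OF hom_poly_holomorphic2])
  fix r :: real assume r: "0 < r" "r < 1"
  have "summable (\<lambda>k. r ^ k)"
    using r by (intro summable_geometric) auto
  then show "\<exists>M. summable M \<and> (\<forall>n z1 z2. cmod z1 \<le> r \<longrightarrow> cmod z2 \<le> r \<longrightarrow>
      cmod (hom_poly n (P n) (fst (z1, z2)) (snd (z1, z2))) \<le> M n)"
    using norm_hom_poly_le[OF deg P r(1)] by (intro exI[of _ "\<lambda>k. r ^ k"]) auto
qed

section \<open>Derivatives at the origin from remainder estimates\<close>

lemma DERIV_of_quadratic_error:
  fixes u :: "complex \<Rightarrow> complex"
  assumes d: "0 < d" and u: "\<And>w. cmod w < d \<Longrightarrow> cmod (u w - (a + b * w)) \<le> C * (cmod w)\<^sup>2"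
  shows "(u has_field_derivative b) (at 0)"
proof -
  have u0: "u 0 = a" using u[of 0] d by simp
  have "((\<lambda>h. (u h - u 0) / h - b) \<longlongrightarrow> 0) (at 0)"
  proof (rule Lim_null_comparison)
    show "((\<lambda>h. C * cmod h) \<longlongrightarrow> 0) (at 0)"
      by (auto intro!: tendsto_eq_intros)
    have "\<forall>\<^sub>F h in at 0. h \<noteq> 0 \<and> cmod h < d"
      using d eventually_at[of "\<lambda>h. h \<noteq> 0 \<and> cmod h < d" 0 UNIV] by (auto simp: dist_norm)
    then show "\<forall>\<^sub>F h in at 0. cmod ((u h - u 0) / h - b) \<le> C * cmod h"
    proof eventually_elim
      case (elim h)
      then have "(u h - u 0) / h - b = (u h - (a + b * h)) / h"
        by (simp add: u0 field_simps)
      then have "cmod ((u h - u 0) / h - b) = cmod (u h - (a + b * h)) / cmod h"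
        by (simp add: norm_divide)
      also have "\<dots> \<le> C * (cmod h)\<^sup>2 / cmod h"
        using u[of h] elim by (intro divide_right_mono) auto
      finally show ?case
        using elim by (simp add: power2_eq_square)
    qed
  qed
  then show ?thesis
    by (simp add: has_field_derivative_iff LIM_zero_cancel)
qed

text \<open>Cauchy's inequality for the error on the circle of radius \<open>m\<close> about
  \<open>z\<close>, which lies in the disc of radius \<open>2 * m\<close> about 0: dividing
  \<open>C * (2 * m) ^ 3\<close> by \<open>m\<close> gives \<open>8 * C * m\<^sup>2\<close>.\<close>

lemma deriv_quadratic_error:
  fixes g :: "complex \<Rightarrow> complex"
  assumes g: "g holomorphic_on ball 0 1" and m: "0 < m" "m < 1/4" and z: "cmod z \<le> m"
    and e: "\<And>w. cmod w \<le> 2 * m \<Longrightarrow> cmod (g w - (a + b * w + c * w\<^sup>2)) \<le> C * (2 * m) ^ 3"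
  shows "cmod (deriv g z - (b + 2 * c * z)) \<le> 8 * C * m\<^sup>2"
proof -
  define h where "h w = g w - (a + b * w + c * w\<^sup>2)" for w
  have near: "cmod w \<le> 2 * m" if "cmod (z - w) \<le> m" for w
    using that z norm_triangle_sub[of w z] by (simp add: norm_minus_commute)
  have hol: "h holomorphic_on ball 0 1"
    unfolding h_def by (intro holomorphic_intros g)
  have hol': "h holomorphic_on cball z m"
    by (rule holomorphic_on_subset[OF hol]) (use near m in \<open>force simp: dist_norm\<close>)
  have "cmod ((deriv ^^ 1) h z) \<le> fact 1 * (C * (2 * m) ^ 3) / m ^ 1"
  proof (rule Cauchy_inequality)
    show "h holomorphic_on ball z m"
      by (rule holomorphic_on_subset[OF hol' ball_subset_cball])
    show "continuous_on (cball z m) h"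
      by (rule holomorphic_on_imp_continuous_on[OF hol'])
    show "cmod (h w) \<le> C * (2 * m) ^ 3" if "cmod (z - w) = m" for w
      unfolding h_def using that by (intro e near) simp
  qed fact
  then have "cmod (deriv h z) \<le> 8 * C * m\<^sup>2"
    using m by (simp add: power2_eq_square power3_eq_cube)
  moreover have "deriv h z = deriv g z - (b + 2 * c * z)"
  proof (rule DERIV_imp_deriv)
    have "(g has_field_derivative deriv g z) (at z)"
      using g z m by (intro holomorphic_derivI[OF g open_ball]) auto
    then show "(h has_field_derivative deriv g z - (b + 2 * c * z)) (at z)"
      unfolding h_def by (auto intro!: derivative_eq_intros simp: algebra_simps)
  qed
  ultimately show ?thesis by simp
qed

text \<open>The cubic error determines the value at the origin. Cauchy's inequality in one variable
  turns it into a quadratic error for each first partial derivative, uniformly in the other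
  variable, and this determines the derivatives of orders one and two.\<close>

lemma mixed_deriv_of_cubic_error:
  assumes q: "q holomorphic2_on bidisc"
    and err: "\<And>z1 z2 m. 0 < m \<Longrightarrow> m < 1/2 \<Longrightarrow> cmod z1 \<le> m \<Longrightarrow> cmod z2 \<le> m \<Longrightarrow>
      cmod (q (z1, z2) - (e00 + e10 * z1 + e01 * z2 + e20 * z1\<^sup>2 + e11 * z1 * z2 + e02 * z2\<^sup>2))
        \<le> C * m ^ 3"
  shows "mixed_deriv (0, 0) q (0, 0) = e00" "mixed_deriv (1, 0) q (0, 0) = e10"
    "mixed_deriv (0, 1) q (0, 0) = e01" "mixed_deriv (2, 0) q (0, 0) = 2 * e20"
    "mixed_deriv (1, 1) q (0, 0) = e11" "mixed_deriv (0, 2) q (0, 0) = 2 * e02"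
proof -
  have q0: "q (0, 0) = e00"
  proof -
    have "cmod (q (0, 0) - e00) \<le> 0"
    proof (rule tendsto_lowerbound)
      show "((\<lambda>m. C * m ^ 3) \<longlongrightarrow> 0) (at_right 0)"
        by (auto intro!: tendsto_eq_intros)
      show "\<forall>\<^sub>F m in at_right 0. cmod (q (0, 0) - e00) \<le> C * m ^ 3"
        using eventually_at_right_real[of 0 "1/2", OF half_gt_zero[OF zero_less_one]] by eventually_elim (use err[of _ 0 0] in auto)
    qed simp
    then show ?thesis by simp
  qed
  have err1: "cmod (pderiv1 q (z1, z2) - (e10 + 2 * e20 * z1 + e11 * z2)) \<le> 8 * C * m\<^sup>2"
    if m: "0 < m" "m < 1/4" "cmod z1 \<le> m" "cmod z2 \<le> m" for z1 z2 m
  proof -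
    have "cmod (deriv (\<lambda>w. q (w, z2)) z1 - ((e10 + e11 * z2) + 2 * e20 * z1)) \<le> 8 * C * m\<^sup>2"
    proof (rule deriv_quadratic_error[OF _ m(1-3)])
      show "(\<lambda>w. q (w, z2)) holomorphic_on ball 0 1"
        by (rule holomorphic2_on_slices[OF q]) (use m in auto)
      show "cmod (q (w, z2) - (e00 + e01 * z2 + e02 * z2\<^sup>2 + (e10 + e11 * z2) * w + e20 * w\<^sup>2))
          \<le> C * (2 * m) ^ 3" if "cmod w \<le> 2 * m" for w
        using err[of "2 * m" w z2] that m by (simp add: algebra_simps)
    qed
    then show ?thesis by (simp add: pderiv1_def algebra_simps)
  qed
  have err2: "cmod (pderiv2 q (z1, z2) - (e01 + 2 * e02 * z2 + e11 * z1)) \<le> 8 * C * m\<^sup>2"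
    if m: "0 < m" "m < 1/4" "cmod z1 \<le> m" "cmod z2 \<le> m" for z1 z2 m
  proof -
    have "cmod (deriv (\<lambda>w. q (z1, w)) z2 - ((e01 + e11 * z1) + 2 * e02 * z2)) \<le> 8 * C * m\<^sup>2"
    proof (rule deriv_quadratic_error[OF _ m(1,2,4)])
      show "(\<lambda>w. q (z1, w)) holomorphic_on ball 0 1"
        by (rule holomorphic2_on_slices[OF q]) (use m in auto)
      show "cmod (q (z1, w) - (e00 + e10 * z1 + e20 * z1\<^sup>2 + (e01 + e11 * z1) * w + e02 * w\<^sup>2))
          \<le> C * (2 * m) ^ 3" if "cmod w \<le> 2 * m" for w
        using err[of "2 * m" z1 w] that m by (simp add: algebra_simps)
    qed
    then show ?thesis by (simp add: pderiv2_def algebra_simps)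
  qed
  have zero: "u = v" if "\<And>m. 0 < m \<Longrightarrow> m < 1/4 \<Longrightarrow> cmod (u - v) \<le> 8 * C * m\<^sup>2" for u v
  proof -
    have "cmod (u - v) \<le> 0"
    proof (rule tendsto_lowerbound)
      show "((\<lambda>m. 8 * C * m\<^sup>2) \<longlongrightarrow> 0) (at_right 0)"
        by (auto intro!: tendsto_eq_intros)
      show "\<forall>\<^sub>F m in at_right 0. cmod (u - v) \<le> 8 * C * m\<^sup>2"
        using eventually_at_right_real[of 0 "1/4", OF divide_pos_pos[OF zero_less_one zero_less_numeral]] by eventually_elim (use that in auto)
    qed simp
    then show ?thesis by simp
  qed
  have p1: "pderiv1 q (0, 0) = e10"
    by (rule zero) (use err1[of _ 0 0] in simp)
  have p2: "pderiv2 q (0, 0) = e01"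
    by (rule zero) (use err2[of _ 0 0] in simp)
  \<comment> \<open>The error bounds are available for positive \<open>m\<close> only. With
    \<open>m = cmod w\<close> they exclude \<open>w = 0\<close>, where the known value
    \<open>u 0 = a\<close> takes over.\<close>
  have lin: "deriv u 0 = b"
    if "u 0 = a" "\<And>w. 0 < cmod w \<Longrightarrow> cmod w < 1/4 \<Longrightarrow> cmod (u w - (a + b * w)) \<le> 8 * C * (cmod w)\<^sup>2"
    for u a b
  proof (rule DERIV_imp_deriv[OF DERIV_of_quadratic_error])
    show "cmod (u w - (a + b * w)) \<le> 8 * C * (cmod w)\<^sup>2" if "cmod w < 1/4" for w
      using \<open>u 0 = a\<close> that(1) \<open>\<And>w. 0 < cmod w \<Longrightarrow> cmod w < 1/4 \<Longrightarrow> cmod (u w - (a + b * w)) \<le> 8 * C * (cmod w)\<^sup>2\<close>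
      by (cases "w = 0") auto
  qed simp
  show "mixed_deriv (0, 0) q (0, 0) = e00" "mixed_deriv (1, 0) q (0, 0) = e10"
    "mixed_deriv (0, 1) q (0, 0) = e01"
    by (simp_all add: mixed_deriv_def q0 p1 p2)
  have "deriv (\<lambda>w. pderiv1 q (w, 0)) 0 = 2 * e20"
    by (rule lin[of "\<lambda>w. pderiv1 q (w, 0)", OF p1]) (use err1[of "cmod w" w 0 for w] in simp)
  then show "mixed_deriv (2, 0) q (0, 0) = 2 * e20"
    by (simp add: mixed_deriv_def numeral_2_eq_2 pderiv1_def[of "pderiv1 q"])
  \<comment> \<open>\<open>mixed_deriv\<close> differentiates in the second variable first, so the
    mixed coefficient is read from \<open>err2\<close> along the first axis.\<close>
  have "deriv (\<lambda>w. pderiv2 q (w, 0)) 0 = e11"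
    by (rule lin[of "\<lambda>w. pderiv2 q (w, 0)", OF p2]) (use err2[of "cmod w" w 0 for w] in simp)
  then show "mixed_deriv (1, 1) q (0, 0) = e11"
    by (simp add: mixed_deriv_def pderiv1_def)
  have "deriv (\<lambda>w. pderiv2 q (0, w)) 0 = 2 * e02"
    by (rule lin[of "\<lambda>w. pderiv2 q (0, w)", OF p2]) (use err2[of "cmod w" 0 w for w] in simp)
  then show "mixed_deriv (0, 2) q (0, 0) = 2 * e02"
    by (simp add: mixed_deriv_def numeral_2_eq_2 pderiv2_def[of "pderiv2 q"])
qed

section \<open>Expansion along lines through the origin\<close>

text \<open>
  By induction on \<open>k\<close>: the quotients \<open>(G l \<zeta> - (\<Sum>j<k. c j \<zeta> * l ^ j)) / l ^ k\<close> are holomorphic in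
  \<open>\<zeta>\<close> and tend to \<open>c k \<zeta>\<close> locally uniformly as \<open>l\<close> tends to 0.
\<close>

lemma Taylor_coeff_entire:
  assumes hol: "\<And>l. cmod l < 1 \<Longrightarrow> (\<lambda>\<zeta>. G l \<zeta>) holomorphic_on {\<zeta>. cmod (l * \<zeta>) < 1}"
    and sums: "\<And>l \<zeta>. cmod l < 1 \<Longrightarrow> cmod (l * \<zeta>) < 1 \<Longrightarrow> (\<lambda>k. c k \<zeta> * l ^ k) sums G l \<zeta>"
    and bound: "\<And>k \<zeta>. cmod (c k \<zeta>) \<le> max 1 (cmod \<zeta>) ^ k"
  shows "c k holomorphic_on UNIV"
proof (induction k rule: less_induct)
  case (less k)
  have "c k holomorphic_on ball 0 N" if N: "1 \<le> N" for N :: real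
  proof (rule holomorphic_uniform_sequence)
    \<comment> \<open>Chosen so that \<open>N * cmod (l n) = 1 / (real n + 2)\<close>. The terms of
      the series are then below powers of this ratio \<open>x\<close> for all arguments in the ball,
      and \<open>x / (1 - x)\<close> is exactly \<open>1 / (real n + 1)\<close>.\<close>
    define l :: "nat \<Rightarrow> complex" where "l n = of_real (1 / (N * (real n + 2)))" for n
    define f where "f n \<zeta> = (G (l n) \<zeta> - (\<Sum>j<k. c j \<zeta> * l n ^ j)) / l n ^ k" for n \<zeta>
    have l: "cmod (l n) = 1 / (N * (real n + 2))" "l n \<noteq> 0" for n
      using N by (auto simp: l_def norm_divide norm_mult simp flip: of_real_add of_real_mult)
    have Nl: "N * cmod (l n) = 1 / (real n + 2)" for n
      using N by (simp add: l)
    have l1: "cmod (l n) < 1" for n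
    proof -
      have "1 < N * (real n + 2)"
        using N mult_mono[of 1 N 2 "real n + 2"] by simp
      then show ?thesis by (simp add: l)
    qed
    have lz: "cmod (l n * \<zeta>) < 1" if "cmod \<zeta> < N" for n \<zeta>
    proof -
      have "cmod (l n * \<zeta>) \<le> N * cmod (l n)"
        using that unfolding norm_mult by (subst mult.commute) (intro mult_right_mono, auto)
      also have "\<dots> < 1" by (simp add: Nl)
      finally show ?thesis .
    qed
    show "f n holomorphic_on ball 0 N" for n
    proof -
      have "G (l n) holomorphic_on ball 0 N"
        by (rule holomorphic_on_subset[OF hol[OF l1]]) (use lz in auto)
      moreover have "c j holomorphic_on ball 0 N" if "j < k" for j
        using less[OF that] by (rule holomorphic_on_subset) simp
      ultimately show ?thesis
        unfolding f_def using l(2) by (intro holomorphic_intros) auto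
    qed
    have err: "cmod (f n \<zeta> - c k \<zeta>) \<le> N ^ k / (real n + 1)" if \<zeta>: "cmod \<zeta> < N" for n \<zeta>
    proof -
      let ?x = "N * cmod (l n)"
      have x: "0 \<le> ?x" "?x < 1" by (simp_all add: Nl)
      have "cmod (c j \<zeta> * l n ^ j) \<le> ?x ^ j" for j
      proof -
        have "cmod (c j \<zeta>) \<le> N ^ j"
          using N \<zeta> by (intro order_trans[OF bound] power_mono) auto
        then show ?thesis
          by (simp add: norm_mult norm_power power_mult_distrib mult_right_mono)
      qed
      from sums_tail_bound[OF sums[OF l1 lz[OF \<zeta>]] this x, of "Suc k"]
      have *: "cmod (G (l n) \<zeta> - (\<Sum>j<Suc k. c j \<zeta> * l n ^ j)) \<le> ?x ^ Suc k / (1 - ?x)" .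
      \<comment> \<open>Subtracting \<open>c k \<zeta>\<close> removes one further term of the
        series: what is left is the remainder from index \<open>Suc k\<close> on, still small after
        division by \<open>l n ^ k\<close>.\<close>
      have "f n \<zeta> - c k \<zeta> = (G (l n) \<zeta> - (\<Sum>j<Suc k. c j \<zeta> * l n ^ j)) / l n ^ k"
        using l(2) by (simp add: f_def field_simps)
      then have "cmod (f n \<zeta> - c k \<zeta>) = cmod (G (l n) \<zeta> - (\<Sum>j<Suc k. c j \<zeta> * l n ^ j)) / cmod (l n) ^ k"
        by (simp add: norm_divide norm_power)
      also have "\<dots> \<le> (?x ^ Suc k / (1 - ?x)) / cmod (l n) ^ k"
        by (intro divide_right_mono *) simp
      also have "\<dots> = N ^ k * (?x / (1 - ?x))"
        using l(2)[of n] by (simp add: power_mult_distrib)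
      also have "?x / (1 - ?x) = 1 / (real n + 1)"
        by (simp add: Nl field_simps)
      finally show ?thesis by simp
    qed
    fix \<zeta> :: complex assume "\<zeta> \<in> ball 0 N"
    then obtain d where d: "0 < d" "cball \<zeta> d \<subseteq> ball 0 N"
      using open_contains_cball open_ball by blast
    have "(\<lambda>n. N ^ k * inverse (real (Suc n))) \<longlonglongrightarrow> N ^ k * 0"
      by (intro tendsto_intros LIMSEQ_inverse_real_of_nat)
    then have lim: "(\<lambda>n. N ^ k / (real n + 1)) \<longlonglongrightarrow> 0"
      by (simp add: field_simps)
    have "uniform_limit (cball \<zeta> d) f (c k) sequentially"
      unfolding uniform_limit_iff
    proof safe
      fix e :: real assume "0 < e"
      then have "\<forall>\<^sub>F n in sequentially. N ^ k / (real n + 1) < e"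
        using lim by (rule order_tendstoD(2)[rotated])
      then show "\<forall>\<^sub>F n in sequentially. \<forall>x\<in>cball \<zeta> d. dist (f n x) (c k x) < e"
      proof eventually_elim
        case (elim n)
        show ?case
        proof
          fix x assume "x \<in> cball \<zeta> d"
          with d have "cmod x < N" by auto
          from err[OF this, of n] elim show "dist (f n x) (c k x) < e"
            by (simp add: dist_norm)
        qed
      qed
    qed
    with d show "\<exists>d>0. cball \<zeta> d \<subseteq> ball 0 N \<and> uniform_limit (cball \<zeta> d) f (c k) sequentially"
      by blast
  qed simp
  then have hol: "c k holomorphic_on ball 0 (cmod z + 1)" for z
    by simp
  have "c k field_differentiable at z" for z
    by (rule holomorphic_on_imp_differentiable_at[OF hol[of z] open_ball]) simp
  then show ?case
    by (simp add: holomorphic_on_def field_differentiable_at_within)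
qed

lemma homogeneous_expansion:
  assumes F: "F holomorphic2_on bidisc"
    and bound: "\<And>z1 z2. cmod z1 < 1 \<Longrightarrow> cmod z2 < 1 \<Longrightarrow> cmod (F (z1, z2)) \<le> 1"
  obtains P where "\<And>k. degree (P k) \<le> k" "\<And>k \<zeta>. cmod (poly (P k) \<zeta>) \<le> max 1 (cmod \<zeta>) ^ k"
    "\<And>l \<zeta>. cmod l < 1 \<Longrightarrow> cmod (l * \<zeta>) < 1 \<Longrightarrow> (\<lambda>k. poly (P k) \<zeta> * l ^ k) sums F (l, l * \<zeta>)"
proof -
  define c where "c k \<zeta> = (deriv ^^ k) (\<lambda>l. F (l, l * \<zeta>)) 0 / fact k" for k \<zeta>
  \<comment> \<open>The radius of the disc of those \<open>l\<close> for which \<open>l\<close> and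
    \<open>l * \<zeta>\<close> both lie in the unit disc; Cauchy's bound is the k-th power of its
    reciprocal.\<close>
  define R where "R \<zeta> = 1 / max 1 (cmod \<zeta>)" for \<zeta> :: complex
  have R: "0 < R \<zeta>" for \<zeta> by (simp add: R_def)
  have ball: "l \<in> ball 0 (R \<zeta>) \<longleftrightarrow> cmod l < 1 \<and> cmod (l * \<zeta>) < 1" for l \<zeta>
  proof -
    have "l \<in> ball 0 (R \<zeta>) \<longleftrightarrow> cmod l * max 1 (cmod \<zeta>) < 1"
      by (simp add: R_def pos_less_divide_eq)
    also have "cmod l * max 1 (cmod \<zeta>) = max (cmod l) (cmod (l * \<zeta>))"
      by (simp add: max_mult_distrib_left norm_mult)
    finally show ?thesis by simp
  qed
  have hol: "(\<lambda>l. F (l, l * \<zeta>)) holomorphic_on ball 0 (R \<zeta>)" for \<zeta>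
    using holomorphic2_on_line[OF F open_ball, of 0 "R \<zeta>" 0 1 0 \<zeta>] ball
    by (simp add: mult.commute)
  have c_bound: "cmod (c k \<zeta>) \<le> max 1 (cmod \<zeta>) ^ k" for k \<zeta>
  proof -
    have "cmod (c k \<zeta>) \<le> 1 / R \<zeta> ^ k"
      unfolding c_def by (rule Taylor_coeff_bound[OF hol R]) (use ball bound in auto)
    then show ?thesis by (simp add: R_def power_divide)
  qed
  have c_sums: "(\<lambda>k. c k \<zeta> * l ^ k) sums F (l, l * \<zeta>)" if "cmod l < 1" "cmod (l * \<zeta>) < 1" for l \<zeta>
    using holomorphic_power_series[OF hol, of l \<zeta>] that ball unfolding c_def by simp
  have c_hol: "c k holomorphic_on UNIV" for k
  proof (rule Taylor_coeff_entire[OF _ c_sums c_bound])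
    fix l :: complex assume l: "cmod l < 1"
    have "open {\<zeta>. cmod (l * \<zeta>) < 1}"
      by (intro open_Collect_less continuous_intros)
    from holomorphic2_on_line[OF F this, of l 0 0 l] l
    show "(\<lambda>\<zeta>. F (l, l * \<zeta>)) holomorphic_on {\<zeta>. cmod (l * \<zeta>) < 1}" by simp
  qed
  \<comment> \<open>By Liouville's theorem the entire function \<open>c k\<close>, growing no faster
    than the k-th power, equals its Taylor polynomial of order \<open>k\<close>.\<close>
  define P where "P k = (\<Sum>j\<le>k. monom ((deriv ^^ j) (c k) 0 / fact j) j)" for k
  have poly_P: "poly (P k) \<zeta> = c k \<zeta>" for k \<zeta>
  proof -
    have "c k \<zeta> = (\<Sum>j\<le>k. (deriv ^^ j) (c k) 0 / fact j * \<zeta> ^ j)"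
    proof (rule Liouville_polynomial[OF c_hol])
      show "cmod (c k z) \<le> 1 * cmod z ^ k" if "1 \<le> cmod z" for z
        using c_bound[of k z] that by (simp add: max_absorb2)
    qed
    then show ?thesis by (simp add: P_def poly_sum poly_monom)
  qed
  show ?thesis
  proof (rule that)
    show "degree (P k) \<le> k" for k
      unfolding P_def by (rule degree_sum_le) (auto intro: order_trans[OF degree_monom_le])
  qed (use c_bound c_sums in \<open>simp_all add: poly_P\<close>)
qed

text \<open>The Schwarz lemma bounds the quotient \<open>h\<close> of \<open>g\<close> by the
  variable; composing \<open>h\<close> with a disc automorphism and applying the lemma again bounds
  \<open>c 2\<close>, the derivative of \<open>h\<close> at 0. The lemma is applied to functions of
  modulus strictly below 1, hence the factors \<open>t < 1\<close> that tend to 1.\<close>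

lemma second_coeff_bound:
  fixes c :: "nat \<Rightarrow> complex"
  assumes sums: "\<And>l. cmod l < 1 \<Longrightarrow> (\<lambda>k. c k * l ^ k) sums g l"
    and g: "\<And>l. cmod l < 1 \<Longrightarrow> cmod (g l) \<le> 1"
    and c: "\<And>k. cmod (c k) \<le> 1" and c0: "c 0 = 0"
  shows "cmod (c 2) \<le> 1 - (cmod (c 1))\<^sup>2"
proof -
  have g_hol: "g holomorphic_on ball 0 1"
    using power_series_holomorphic[of 0 1 c g] sums by simp
  have g0: "g 0 = 0"
    using sums_unique2[OF sums[of 0] powser_sums_zero[of c]] c0 by simp
  have g_le: "cmod (g l) \<le> cmod l" if l: "cmod l < 1" for l
  proof (rule tendsto_upperbound)
    show "((\<lambda>t. t * cmod (g l)) \<longlongrightarrow> cmod (g l)) (at_left 1)"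
      by (auto intro!: tendsto_eq_intros)
    show "\<forall>\<^sub>F t in at_left 1. t * cmod (g l) \<le> cmod l"
      using eventually_at_left_real[of 0 1, OF zero_less_one]
    proof eventually_elim
      case (elim t)
      have "cmod (of_real t * g l) \<le> cmod l"
      proof (rule Schwarz_Lemma(1)[of "\<lambda>l. of_real t * g l"])
        show "cmod (of_real t * g z) < 1" if "cmod z < 1" for z
        proof -
          have "t * cmod (g z) \<le> t * 1" using elim g[OF that] by (intro mult_left_mono) auto
          also have "\<dots> < 1" using elim by simp
          finally show ?thesis using elim by (simp add: norm_mult)
        qed
      qed (auto intro!: holomorphic_intros g_hol simp: g0 l)
      then show ?case using elim by (simp add: norm_mult)
    qed
  qed simp
  \<comment> \<open>The shifted series represents \<open>g l / l\<close> without a removable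
    singularity at 0.\<close>
  define h where "h l = (\<Sum>k. c (Suc k) * l ^ k)" for l
  have h_sums: "(\<lambda>k. c (Suc k) * l ^ k) sums h l" if "cmod l < 1" for l
  proof -
    have "summable (\<lambda>k. cmod l ^ k)" using that by (intro summable_geometric) auto
    then have "summable (\<lambda>k. c (Suc k) * l ^ k)"
      by (rule summable_comparison_test')
        (use c in \<open>auto simp: norm_mult norm_power mult_left_le_one_le\<close>)
    then show ?thesis unfolding h_def by (rule summable_sums)
  qed
  have h_hol: "h holomorphic_on ball 0 1"
    using power_series_holomorphic[of 0 1 "\<lambda>k. c (Suc k)" h] h_sums by simp
  have h0: "h 0 = c 1"
    using sums_unique2[OF h_sums[of 0] powser_sums_zero[of "\<lambda>k. c (Suc k)"]] by simp
  have g_eq: "g l = l * h l" if "cmod l < 1" for l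
  proof (rule sums_unique2[OF sums[OF that]])
    have "(\<lambda>k. c (Suc k) * l ^ Suc k) sums (l * h l)"
      using sums_mult[OF h_sums[OF that], of l] by (simp add: mult_ac)
    then show "(\<lambda>k. c k * l ^ k) sums (l * h l)"
      using sums_Suc[of "\<lambda>k. c k * l ^ k"] c0 by simp
  qed
  have h_le: "cmod (h l) \<le> 1" if "cmod l < 1" for l
  proof (cases "l = 0")
    case False
    then show ?thesis using g_le[OF that] g_eq[OF that] by (simp add: norm_mult)
  qed (use c[of 1] h0 in simp)
  \<comment> \<open>The last argument 2 bounds \<open>1 / (1 - cmod w)\<close> for
    \<open>cmod w < 1/2\<close>.\<close>
  have h_deriv: "(h has_field_derivative c 2) (at 0)"
  proof (rule DERIV_of_quadratic_error[of "1/2" h "c 1" "c 2" 2])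
    fix w :: complex assume w: "cmod w < 1/2"
    have "cmod (h w - (\<Sum>k<2. c (Suc k) * w ^ k)) \<le> cmod w ^ 2 / (1 - cmod w)"
      by (rule sums_tail_bound[OF h_sums])
        (use w c in \<open>auto simp: norm_mult norm_power mult_left_le_one_le\<close>)
    also have "\<dots> \<le> cmod w ^ 2 / (1/2)"
      using w by (intro divide_left_mono) auto
    finally show "cmod (h w - (c 1 + c 2 * w)) \<le> 2 * (cmod w)\<^sup>2"
      by (simp add: numeral_2_eq_2 mult.commute)
  qed simp
  have "t * cmod (c 2) \<le> 1 - (t * cmod (c 1))\<^sup>2" if t: "0 < t" "t < 1" for t :: real
  proof -
    define a where "a = of_real t * c 1"
    have th: "cmod (of_real t * h l) < 1" if "cmod l < 1" for l
    proof -
      have "t * cmod (h l) \<le> t * 1" using t h_le[OF that] by (intro mult_left_mono) auto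
      also have "\<dots> < 1" using t by simp
      finally show ?thesis using t by (simp add: norm_mult)
    qed
    have a: "cmod a < 1" using th[of 0] by (simp add: a_def h0)
    have pos: "(cmod a)\<^sup>2 < 1" using a by (simp add: abs_square_less_1)
    have den: "1 - cnj a * (of_real t * h l) \<noteq> 0" if "cmod l < 1" for l
    proof
      assume "1 - cnj a * (of_real t * h l) = 0"
      then have "cmod (cnj a * (of_real t * h l)) = 1"
        by (metis eq_iff_diff_eq_0 norm_one)
      moreover have "cmod (cnj a) * cmod (of_real t * h l) < 1"
        using a th[OF that] by (metis complex_mod_cnj mult.left_neutral mult_strict_mono' norm_ge_zero)
      ultimately show False by (simp add: norm_mult)
    qed
    \<comment> \<open>The disc automorphism sends \<open>a\<close>, the value of the scaled
      \<open>h\<close> at 0, to 0. In the quotient rule at 0 the term with the numerator therefore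
      vanishes.\<close>
    define k where "k l = (of_real t * h l - a) / (1 - cnj a * (of_real t * h l))" for l
    have "cmod (deriv k 0) \<le> 1"
    proof (rule Schwarz_Lemma(2)[of k 0])
      show "k holomorphic_on ball 0 1"
        unfolding k_def using den by (intro holomorphic_intros h_hol) auto
      show "k 0 = 0" by (simp add: k_def a_def h0)
      show "cmod (k z) < 1" if "cmod z < 1" for z
        using Moebius_function_norm_lt_1[OF a th[OF that], of 0]
        by (simp add: Moebius_function_def k_def)
    qed simp
    moreover have "deriv k 0 = of_real t * c 2 / of_real (1 - (cmod a)\<^sup>2)"
    proof (rule DERIV_imp_deriv)
      have "(k has_field_derivative ((of_real t * c 2) * (1 - cnj a * (of_real t * h 0))
          - (of_real t * h 0 - a) * (- (cnj a * (of_real t * c 2))))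
          / ((1 - cnj a * (of_real t * h 0)) * (1 - cnj a * (of_real t * h 0)))) (at 0)"
        unfolding k_def using den[of 0] by (auto intro!: derivative_eq_intros h_deriv)
      moreover have "of_real t * h 0 = a" by (simp add: a_def h0)
      moreover have "1 - cnj a * a = of_real (1 - (cmod a)\<^sup>2)"
        using complex_norm_square[of a] by (simp add: mult.commute)
      moreover have "(complex_of_real (cmod a))\<^sup>2 \<noteq> 1"
        using pos by (metis less_irrefl of_real_eq_1_iff of_real_power)
      ultimately show "(k has_field_derivative of_real t * c 2 / of_real (1 - (cmod a)\<^sup>2)) (at 0)"
        by simp
    qed
    ultimately have "cmod (of_real t * c 2) / (1 - (cmod a)\<^sup>2) \<le> 1"
      using pos by (simp add: norm_divide del: of_real_diff)
    then show ?thesis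
      using pos t by (simp add: norm_mult a_def)
  qed
  note * = this
  show ?thesis
  proof (rule tendsto_le)
    show "((\<lambda>t. t * cmod (c 2)) \<longlongrightarrow> cmod (c 2)) (at_left 1)"
      by (auto intro!: tendsto_eq_intros)
    show "((\<lambda>t. 1 - (t * cmod (c 1))\<^sup>2) \<longlongrightarrow> 1 - (cmod (c 1))\<^sup>2) (at_left 1)"
      by (auto intro!: tendsto_eq_intros)
    show "\<forall>\<^sub>F t in at_left 1. t * cmod (c 2) \<le> 1 - (t * cmod (c 1))\<^sup>2"
      using eventually_at_left_real[of 0 1, OF zero_less_one]
      by eventually_elim (use * in auto)
  qed simp
qed

section \<open>The two implications\<close>

text \<open>Each partial sum is multiplication by a partial sum of the symbol, which differs from
  \<open>G\<close> by at most a geometric tail, uniformly on the circle; the tail vanishes in the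
  limit.\<close>

lemma norm_op_series_mult_op_le:
  assumes P: "\<And>k \<zeta>. cmod \<zeta> = 1 \<Longrightarrow> cmod (poly (P k) \<zeta>) \<le> 1"
    and sums: "\<And>\<zeta>. cmod \<zeta> = 1 \<Longrightarrow> (\<lambda>k. poly (P k) \<zeta> * z ^ k) sums G \<zeta>"
    and G: "\<And>\<zeta>. cmod \<zeta> = 1 \<Longrightarrow> cmod (G \<zeta>) \<le> 1"
    and summ: "summable_coeffs (\<lambda>k. mult_op (poly (P k)))" and z: "cmod z < 1"
  shows "norm (op_series (\<lambda>k. mult_op (poly (P k))) z) \<le> 1"
proof -
  let ?S = "\<lambda>n. \<Sum>k<n. scaleC_op (z ^ k) (mult_op (poly (P k)))"
  have cont: "continuous_on (sphere 0 1) (poly (P k))" for k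
    by (intro continuous_intros)
  have "norm (?S n) \<le> 1 + cmod z ^ n / (1 - cmod z)" for n
  proof -
    have "?S n = mult_op (\<lambda>\<zeta>. \<Sum>k<n. z ^ k * poly (P k) \<zeta>)"
      by (rule mult_op_sum[OF cont, symmetric])
    also have "norm \<dots> \<le> 1 + cmod z ^ n / (1 - cmod z)"
    proof (rule norm_mult_op_le)
      fix \<zeta> :: complex assume "\<zeta> \<in> sphere 0 1"
      then have \<zeta>: "cmod \<zeta> = 1" by simp
      let ?T = "\<Sum>k<n. poly (P k) \<zeta> * z ^ k"
      have "cmod (G \<zeta> - ?T) \<le> cmod z ^ n / (1 - cmod z)"
        by (rule sums_tail_bound[OF sums[OF \<zeta>]])
          (use P[OF \<zeta>] z in \<open>auto simp: norm_mult norm_power mult_left_le_one_le\<close>)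
      then have "cmod ?T \<le> 1 + cmod z ^ n / (1 - cmod z)"
        using G[OF \<zeta>] norm_triangle_sub[of ?T "G \<zeta>"] by (simp add: norm_minus_commute)
      then show "cmod (\<Sum>k<n. z ^ k * poly (P k) \<zeta>) \<le> 1 + cmod z ^ n / (1 - cmod z)"
        by (simp add: mult.commute)
    qed (use z in \<open>auto intro!: continuous_intros\<close>)
    finally show ?thesis .
  qed
  moreover have "(\<lambda>n. 1 + cmod z ^ n / (1 - cmod z)) \<longlonglongrightarrow> 1 + 0 / (1 - cmod z)"
    using z by (intro tendsto_intros LIMSEQ_realpow_zero) auto
  moreover have "(\<lambda>n. norm (?S n)) \<longlonglongrightarrow> norm (op_series (\<lambda>k. mult_op (poly (P k))) z)"
    using op_series_sums[OF summ z] by (intro tendsto_norm) (simp add: sums_def)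
  ultimately show ?thesis
    by (intro LIMSEQ_le[of _ _ _ 1]) auto
qed

text \<open>The pointwise lower bound for the norm of a multiplication operator is applied to the
  partial sums, whose symbols are continuous, and survives the limit.\<close>

lemma norm_sum_le_of_norm_op_series_le:
  assumes summ: "summable_coeffs (\<lambda>k. mult_op (poly (P k)))" and z: "cmod z < 1"
    and le: "norm (op_series (\<lambda>k. mult_op (poly (P k))) z) \<le> 1"
    and \<zeta>: "cmod \<zeta> = 1" and sums: "(\<lambda>k. poly (P k) \<zeta> * z ^ k) sums s"
  shows "cmod s \<le> 1"
proof -
  let ?S = "\<lambda>n. \<Sum>k<n. scaleC_op (z ^ k) (mult_op (poly (P k)))"
  have cont: "continuous_on (sphere 0 1) (poly (P k))" for k
    by (intro continuous_intros)
  have "cmod (\<Sum>k<n. poly (P k) \<zeta> * z ^ k) \<le> norm (?S n)" for n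
  proof -
    have "cmod (\<Sum>k<n. z ^ k * poly (P k) \<zeta>) \<le> norm (mult_op (\<lambda>\<zeta>. \<Sum>k<n. z ^ k * poly (P k) \<zeta>))"
      by (rule norm_le_norm_mult_op) (use \<zeta> in \<open>auto intro!: continuous_intros\<close>)
    also have "mult_op (\<lambda>\<zeta>. \<Sum>k<n. z ^ k * poly (P k) \<zeta>) = ?S n"
      by (rule mult_op_sum[OF cont])
    finally show ?thesis by (simp add: mult.commute)
  qed
  moreover have "(\<lambda>n. norm (?S n)) \<longlonglongrightarrow> norm (op_series (\<lambda>k. mult_op (poly (P k))) z)"
    using op_series_sums[OF summ z] by (intro tendsto_norm) (simp add: sums_def)
  moreover have "(\<lambda>n. cmod (\<Sum>k<n. poly (P k) \<zeta> * z ^ k)) \<longlonglongrightarrow> cmod s"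
    using sums by (intro tendsto_norm) (simp add: sums_def)
  ultimately have "cmod s \<le> norm (op_series (\<lambda>k. mult_op (poly (P k))) z)"
    by (intro LIMSEQ_le) auto
  with le show ?thesis by simp
qed

lemma hom_poly_0: "hom_poly 0 P z1 z2 = coeff P 0"
  and hom_poly_1: "hom_poly 1 P z1 z2 = coeff P 0 * z1 + coeff P 1 * z2"
  and hom_poly_2: "hom_poly 2 P z1 z2 = coeff P 0 * z1\<^sup>2 + coeff P 1 * z1 * z2 + coeff P 2 * z2\<^sup>2"
  by (simp_all add: hom_poly_def numeral_2_eq_2)

lemma poly_eqI_degree_le_2:
  fixes P Q :: "'a :: zero poly"
  assumes "degree P \<le> 2" "degree Q \<le> 2" "coeff P 0 = coeff Q 0" "coeff P 1 = coeff Q 1"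
    "coeff P 2 = coeff Q 2"
  shows "P = Q"
proof (rule poly_eqI)
  fix n :: nat
  consider "n = 0" | "n = 1" | "n = 2" | "n > 2" by linarith
  then show "coeff P n = coeff Q n"
    using assms by cases (auto simp: coeff_eq_0)
qed

text \<open>A point with nonzero first coordinate lies on a line \<open>(w, w * \<zeta>)\<close>,
  where the terms of the series are at most \<open>m ^ k\<close>. The tail from index 3 is then at
  most \<open>m ^ 3 / (1 - m)\<close>, and \<open>m < 1/2\<close> gives the factor 2.\<close>

lemma cubic_error_of_expansion:
  assumes F: "F holomorphic2_on bidisc"
    and deg: "\<And>k. degree (P k) \<le> k"
    and bound: "\<And>k \<zeta>. cmod (poly (P k) \<zeta>) \<le> max 1 (cmod \<zeta>) ^ k"
    and sums: "\<And>l \<zeta>. cmod l < 1 \<Longrightarrow> cmod (l * \<zeta>) < 1 \<Longrightarrow>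
      (\<lambda>k. poly (P k) \<zeta> * l ^ k) sums F (l, l * \<zeta>)"
    and m: "0 < m" "m < 1/2" "cmod z1 \<le> m" "cmod z2 \<le> m"
  shows "cmod (F (z1, z2) - (\<Sum>k<3. hom_poly k (P k) z1 z2)) \<le> 2 * m ^ 3"
proof -
  have nonzero: "cmod (F (w, z2) - (\<Sum>k<3. hom_poly k (P k) w z2)) \<le> 2 * m ^ 3"
    if w: "w \<noteq> 0" "cmod w \<le> m" for w
  proof -
    define \<zeta> where "\<zeta> = z2 / w"
    have z2: "z2 = w * \<zeta>" using w by (simp add: \<zeta>_def)
    have "cmod (poly (P k) \<zeta> * w ^ k) \<le> m ^ k" for k
    proof -
      have "cmod (poly (P k) \<zeta> * w ^ k) \<le> (max 1 (cmod \<zeta>) * cmod w) ^ k"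
        unfolding norm_mult norm_power power_mult_distrib
        by (intro mult_right_mono bound) simp
      also have "max 1 (cmod \<zeta>) * cmod w = max (cmod w) (cmod z2)"
        by (simp add: z2 max_mult_distrib_right norm_mult mult.commute[of "cmod w"])
      also have "max (cmod w) (cmod z2) ^ k \<le> m ^ k"
        using w m by (intro power_mono) (auto simp: le_max_iff_disj)
      finally show ?thesis .
    qed
    then have "cmod (F (w, z2) - (\<Sum>k<3. poly (P k) \<zeta> * w ^ k)) \<le> m ^ 3 / (1 - m)"
      using m w z2 by (intro sums_tail_bound) (auto intro!: sums)
    also have "\<dots> \<le> m ^ 3 / (1/2)"
      using m by (intro divide_left_mono) auto
    also have "(\<Sum>k<3. poly (P k) \<zeta> * w ^ k) = (\<Sum>k<3. hom_poly k (P k) w z2)"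
      unfolding z2 hom_poly_eq[OF deg] by (simp add: mult.commute)
    finally show ?thesis by simp
  qed
  show ?thesis
  proof (cases "z1 = 0")
    case True
    \<comment> \<open>On the excluded axis the estimate follows by letting the first coordinate tend
      to 0 with \<open>z2\<close> fixed.\<close>
    let ?f = "\<lambda>w. cmod (F (w, z2) - (\<Sum>k<3. hom_poly k (P k) w z2))"
    have "(\<lambda>w. F (w, z2) - (\<Sum>k<3. hom_poly k (P k) w z2)) holomorphic_on ball 0 1"
      using holomorphic2_on_slices(1)[OF F] m
      by (intro holomorphic_on_diff holomorphic_on_sum hom_poly_holomorphic) auto
    then have "continuous_on (ball 0 1) ?f"
      by (intro continuous_on_norm holomorphic_on_imp_continuous_on)
    then have "isCont ?f 0"
      by (simp add: continuous_on_eq_continuous_at)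
    then have "(?f \<longlongrightarrow> ?f 0) (at 0)"
      by (simp add: isCont_def)
    moreover have "\<forall>\<^sub>F w in at 0. ?f w \<le> 2 * m ^ 3"
    proof -
      have "\<forall>\<^sub>F w in at 0. w \<noteq> 0 \<and> cmod w \<le> m"
        using m(1) eventually_at[of "\<lambda>w. w \<noteq> 0 \<and> cmod w \<le> m" 0 UNIV] by (auto intro!: exI[of _ m])
      then show ?thesis
        by eventually_elim (use nonzero in auto)
    qed
    ultimately have "?f 0 \<le> 2 * m ^ 3"
      by (rule tendsto_upperbound) simp
    then show ?thesis using True by simp
  qed (use nonzero m in auto)
qed

theorem theorem3p2:
  fixes a10 a01 a20 a11 a02 :: complex
    and p :: "complex \<times> complex \<Rightarrow> complex"
    and p0 p1 p2 :: "complex poly"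
  assumes p: "\<And>z1 z2. p (z1, z2) = a10 * z1 + a01 * z2 + a20 * z1^2 + a11 * z1 * z2 + a02 * z2^2"
    and p0: "p0 = 0"
    and p1: "p1 = [:a10, a01:]"
    and p2: "p2 = [:a20, a11, a02:]"
  shows
    "(\<exists>q :: complex \<times> complex \<Rightarrow> complex.
        q holomorphic2_on bidisc \<and>
        (\<forall>i1 i2. i1 + i2 \<le> 2 \<longrightarrow> mixed_deriv (i1, i2) q (0, 0) = 0) \<and>
        (SUP z\<in>bidisc. ereal (cmod (p z + q z))) \<le> 1)
     \<longleftrightarrow>
     (\<forall>z\<in>ball 0 1. cmod (poly p2 z) \<le> 1 - (cmod (poly p1 z))^2) \<and>
     (\<exists>(P :: nat \<Rightarrow> complex poly) (f :: complex \<Rightarrow> L2_circle \<Rightarrow>\<^sub>L L2_circle).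
        P 0 = p0 \<and> P 1 = p1 \<and> P 2 = p2 \<and>
        (\<forall>k\<ge>3. degree (P k) \<le> k) \<and>
        f op_holomorphic_on ball 0 1 \<and>
        (\<forall>k. (op_deriv ^^ k) f 0 /\<^sub>R fact k = mult_op (poly (P k))) \<and>
        (SUP z\<in>ball 0 1. ereal (norm (f z))) \<le> 1)"
    (is "?L \<longleftrightarrow> ?R1 \<and> ?R2")
proof -
  have p_eq: "p = (\<lambda>z. hom_poly 1 p1 (fst z) (snd z) + hom_poly 2 p2 (fst z) (snd z))"
  proof
    show "p z = hom_poly 1 p1 (fst z) (snd z) + hom_poly 2 p2 (fst z) (snd z)" for z
      by (cases z, simp only: p p1 p2 hom_poly_1 hom_poly_2 fst_conv snd_conv)
        (simp add: numeral_2_eq_2)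
  qed
  have p_hol: "p holomorphic2_on bidisc"
    unfolding p_eq by (intro holomorphic2_on_add hom_poly_holomorphic2)
  have necessity: "?R1 \<and> ?R2" if ?L
  proof -
    from that obtain q where q: "q holomorphic2_on bidisc"
      and dq: "\<And>i1 i2. i1 + i2 \<le> 2 \<Longrightarrow> mixed_deriv (i1, i2) q (0, 0) = 0"
      and sup: "(SUP z\<in>bidisc. ereal (cmod (p z + q z))) \<le> 1"
      by blast
    define F where "F z = p z + q z" for z
    have F: "F holomorphic2_on bidisc"
      unfolding F_def by (intro holomorphic2_on_add p_hol q)
    have F_le: "cmod (F (z1, z2)) \<le> 1" if "cmod z1 < 1" "cmod z2 < 1" for z1 z2
    proof -
      have "(z1, z2) \<in> bidisc" using that by (simp add: bidisc_def)
      then show ?thesis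
        using sup unfolding F_def SUP_le_iff by auto
    qed
    obtain P where
      deg: "\<And>k. degree (P k) \<le> k" and P: "\<And>k \<zeta>. cmod (poly (P k) \<zeta>) \<le> max 1 (cmod \<zeta>) ^ k"
      and sums: "\<And>l \<zeta>. cmod l < 1 \<Longrightarrow> cmod (l * \<zeta>) < 1 \<Longrightarrow>
        (\<lambda>k. poly (P k) \<zeta> * l ^ k) sums F (l, l * \<zeta>)"
      by (rule homogeneous_expansion[OF F F_le]) (assumption | rule that)+
    \<comment> \<open>The six coefficients are those of \<open>F\<close> up to order two minus those
      of \<open>p\<close>, which has no constant term. The vanishing derivatives of \<open>q\<close>
      force each of them to be 0.\<close>
    have "cmod (q (z1, z2) - (coeff (P 0) 0 + (coeff (P 1) 0 - a10) * z1 + (coeff (P 1) 1 - a01) * z2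
        + (coeff (P 2) 0 - a20) * z1\<^sup>2 + (coeff (P 2) 1 - a11) * z1 * z2
        + (coeff (P 2) 2 - a02) * z2\<^sup>2)) \<le> 2 * m ^ 3"
      if "0 < m" "m < 1/2" "cmod z1 \<le> m" "cmod z2 \<le> m" for z1 z2 m
    proof -
      have "(\<Sum>k<3. hom_poly k (P k) z1 z2)
          = hom_poly 0 (P 0) z1 z2 + hom_poly 1 (P 1) z1 z2 + hom_poly 2 (P 2) z1 z2"
        by (simp add: numeral_3_eq_3 numeral_2_eq_2)
      then show ?thesis
        using cubic_error_of_expansion[OF F deg P sums that]
        unfolding F_def p hom_poly_0 hom_poly_1 hom_poly_2 by (simp add: algebra_simps)
    qed
    note coeffs = mixed_deriv_of_cubic_error[OF q this]
    have P0: "P 0 = p0"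
      using coeffs(1) dq[of 0 0] deg[of 0] unfolding p0 by (intro poly_eqI_degree_le_2) (auto simp: coeff_eq_0)
    have P1: "P 1 = p1"
      using coeffs(2,3) dq[of 1 0] dq[of 0 1] deg[of 1] unfolding p1
      by (intro poly_eqI_degree_le_2) (auto simp: coeff_eq_0)
    have P2: "P 2 = p2"
      using coeffs(4-6) dq[of 2 0] dq[of 1 1] dq[of 0 2] deg[of 2] unfolding p2
      by (intro poly_eqI_degree_le_2) (auto simp: coeff_eq_0 numeral_2_eq_2)
    have "cmod (poly p2 z) \<le> 1 - (cmod (poly p1 z))\<^sup>2" if z: "z \<in> ball 0 1" for z
    proof -
      have lz: "cmod (l * z) < 1" if "cmod l < 1" for l
        using norm_mult_less[OF that, of z 1] z by simp
      have "cmod (poly (P 2) z) \<le> 1 - (cmod (poly (P 1) z))\<^sup>2"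
      proof (rule second_coeff_bound)
        show "(\<lambda>k. poly (P k) z * l ^ k) sums F (l, l * z)" if "cmod l < 1" for l
          using that lz by (intro sums)
        show "cmod (F (l, l * z)) \<le> 1" if "cmod l < 1" for l
          using that lz by (intro F_le)
        show "cmod (poly (P k) z) \<le> 1" for k
          using P[of k z] z by (simp add: max_absorb1)
      qed (simp add: P0 p0)
      then show ?thesis unfolding P1 P2 .
    qed
    moreover have ?R2
    proof -
      let ?A = "\<lambda>k. mult_op (poly (P k))"
      have P_le: "cmod (poly (P k) \<zeta>) \<le> 1" if "cmod \<zeta> = 1" for k \<zeta>
        using P[of k \<zeta>] that by simp
      have "norm (?A k) \<le> 1" for k
        by (rule norm_mult_op_le) (auto intro!: continuous_intros P_le)
      then have summ: "summable_coeffs ?A" by (rule summable_coeffs_bounded)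
      have "norm (op_series ?A z) \<le> 1" if "cmod z < 1" for z
      proof (rule norm_op_series_mult_op_le[OF P_le _ _ summ that])
        show "(\<lambda>k. poly (P k) \<zeta> * z ^ k) sums F (z, z * \<zeta>)" if "cmod \<zeta> = 1" for \<zeta>
          using that \<open>cmod z < 1\<close> by (intro sums) (auto simp: norm_mult)
        show "cmod (F (z, z * \<zeta>)) \<le> 1" if "cmod \<zeta> = 1" for \<zeta>
          using that \<open>cmod z < 1\<close> by (intro F_le) (auto simp: norm_mult)
      qed
      then have sup: "(SUP z\<in>ball 0 1. ereal (norm (op_series ?A z))) \<le> 1"
        by (auto simp: SUP_le_iff)
      have hol: "op_series ?A op_holomorphic_on ball 0 1"
        by (rule op_series_holomorphic[OF summ mult_op_B_L2])
      have "\<forall>k. (op_deriv ^^ k) (op_series ?A) 0 /\<^sub>R fact k = ?A k"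
        by (rule allI, rule op_deriv_0_eq_coeff[OF summ refl])
      with sup hol P0 P1 P2 deg show ?thesis
        by (intro exI[of _ P] exI[of _ "op_series ?A"] conjI) auto
    qed
    ultimately show ?thesis by blast
  qed
  have sufficiency: ?L if R2: ?R2
  proof -
    from R2 obtain P f where P012: "P 0 = p0" "P 1 = p1" "P 2 = p2"
      and deg3: "\<And>k. k \<ge> 3 \<Longrightarrow> degree (P k) \<le> k"
      and f: "f op_holomorphic_on ball 0 1"
      and coeff: "\<And>k. (op_deriv ^^ k) f 0 /\<^sub>R fact k = mult_op (poly (P k))"
      and sup: "(SUP z\<in>ball 0 1. ereal (norm (f z))) \<le> 1"
      by blast
    have f_le: "norm (f z) \<le> 1" if "cmod z < 1" for z
      using sup that unfolding SUP_le_iff by auto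
    have deg: "degree (P k) \<le> k" for k
    proof -
      consider "k = 0" | "k = 1" | "k = 2" | "k \<ge> 3" by linarith
      then show ?thesis
        by cases (use P012 deg3 in \<open>auto simp: p0 p1 p2\<close>)
    qed
    obtain A where A: "\<And>k. norm (A k) \<le> 1" and f_eq: "\<And>z. cmod z < 1 \<Longrightarrow> f z = op_series A z"
      using op_holomorphic_eq_series[OF f f_le] by blast
    have summ: "summable_coeffs A" by (rule summable_coeffs_bounded[OF A])
    \<comment> \<open>The prescribed derivatives at 0 identify the coefficients of the power series
      of \<open>f\<close>, so the Cauchy bound on \<open>A k\<close> becomes a bound on the symbol
      \<open>poly (P k)\<close>.\<close>
    have A_eq: "A = (\<lambda>k. mult_op (poly (P k)))"
      using op_deriv_0_eq_coeff[OF summ f_eq] coeff by (simp add: fun_eq_iff)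
    have P_le: "cmod (poly (P k) \<zeta>) \<le> 1" if "cmod \<zeta> = 1" for k \<zeta>
    proof -
      have "cmod (poly (P k) \<zeta>) \<le> norm (mult_op (poly (P k)))"
        by (rule norm_le_norm_mult_op) (use that in \<open>auto intro!: continuous_intros\<close>)
      then show ?thesis using A[of k] by (simp add: A_eq)
    qed
    define F where "F z = (\<Sum>k. hom_poly k (P k) (fst z) (snd z))" for z
    have F: "F holomorphic2_on bidisc"
      unfolding F_def by (rule hom_poly_series_holomorphic2[OF deg P_le])
    have F_sums: "(\<lambda>k. hom_poly k (P k) z1 z2) sums F (z1, z2)" if "cmod z1 < 1" "cmod z2 < 1" for z1 z2
      using hom_poly_series_sums[OF deg P_le that] by (simp add: F_def)
    have F_torus: "cmod (F (z1, z2)) \<le> 1" if z: "cmod z1 = r" "cmod z2 = r" and r: "0 < r" "r < 1" for z1 z2 r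
    proof -
      \<comment> \<open>On the torus this quotient is unimodular, so the series for \<open>F\<close>
        becomes the symbol series of the operator \<open>f z1\<close> evaluated at a point of the
        circle.\<close>
      define \<zeta> where "\<zeta> = z2 / z1"
      have z2: "z2 = z1 * \<zeta>" and \<zeta>: "cmod \<zeta> = 1"
        using z r by (auto simp: \<zeta>_def norm_divide)
      have z1: "cmod z1 < 1" using z r by simp
      show ?thesis
      proof (rule norm_sum_le_of_norm_op_series_le[OF _ z1 _ \<zeta>])
        show "summable_coeffs (\<lambda>k. mult_op (poly (P k)))" using summ unfolding A_eq .
        show "norm (op_series (\<lambda>k. mult_op (poly (P k))) z1) \<le> 1"
          using f_eq[OF z1] f_le[OF z1] unfolding A_eq by simp
        show "(\<lambda>k. poly (P k) \<zeta> * z1 ^ k) sums F (z1, z2)"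
          using F_sums[OF z1, of z2] z r unfolding z2 hom_poly_eq[OF deg] by (simp add: mult.commute)
      qed
    qed
    have F_le: "cmod (F (z1, z2)) \<le> 1" if z: "cmod z1 < 1" "cmod z2 < 1" for z1 z2
    proof -
      obtain r where r: "max (cmod z1) (cmod z2) < r" "r < 1"
        using z dense[of "max (cmod z1) (cmod z2)" 1] by auto
      then have r0: "0 < r" using norm_ge_zero[of z1] by linarith
      show ?thesis
      proof (rule polydisc_maximum_modulus[where F = "\<lambda>z1 z2. F (z1, z2)" and r = r])
        show "(\<lambda>z1. F (z1, z2)) holomorphic_on cball 0 r" if "cmod z2 \<le> r" for z2
          by (rule holomorphic_on_subset[OF holomorphic2_on_slices(1)[OF F]]) (use that r in auto)
        show "(\<lambda>z2. F (z1, z2)) holomorphic_on cball 0 r" if "cmod z1 \<le> r" for z1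
          by (rule holomorphic_on_subset[OF holomorphic2_on_slices(2)[OF F]]) (use that r in auto)
      qed (use r r0 F_torus in auto)
    qed
    define q where "q z = F z - p z" for z
    have q: "q holomorphic2_on bidisc"
      unfolding q_def by (intro holomorphic2_on_diff F p_hol)
    \<comment> \<open>Subtracting \<open>p\<close> cancels exactly the homogeneous terms of degree
      below 3. The remainder estimate therefore holds with all six coefficients equal to 0.\<close>
    have "cmod (q (z1, z2) - (0 + 0 * z1 + 0 * z2 + 0 * z1\<^sup>2 + 0 * z1 * z2 + 0 * z2\<^sup>2)) \<le> 2 * m ^ 3"
      if m: "0 < m" "m < 1/2" "cmod z1 \<le> m" "cmod z2 \<le> m" for z1 z2 m
    proof -
      have "(\<Sum>k<3. hom_poly k (P k) z1 z2)
          = hom_poly 0 (P 0) z1 z2 + hom_poly 1 (P 1) z1 z2 + hom_poly 2 (P 2) z1 z2"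
        by (simp add: numeral_3_eq_3 numeral_2_eq_2)
      also have "\<dots> = p (z1, z2)"
        by (simp only: P012 p_eq p0 hom_poly_0 fst_conv snd_conv) simp
      finally have "q (z1, z2) = F (z1, z2) - (\<Sum>k<3. hom_poly k (P k) z1 z2)"
        by (simp add: q_def)
      also have "cmod \<dots> \<le> m ^ 3 / (1 - m)"
        using m by (intro sums_tail_bound F_sums norm_hom_poly_le deg P_le) auto
      also have "\<dots> \<le> m ^ 3 / (1/2)"
        using m by (intro divide_left_mono) auto
      finally show ?thesis by simp
    qed
    note dq = mixed_deriv_of_cubic_error[OF q this]
    have "mixed_deriv (i1, i2) q (0, 0) = 0" if "i1 + i2 \<le> 2" for i1 i2
    proof -
      have "(i1, i2) \<in> {(0, 0), (1, 0), (0, 1), (2, 0), (1, 1), (0, 2)}"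
        using that by auto
      then show ?thesis using dq by auto
    qed
    moreover have "(SUP z\<in>bidisc. ereal (cmod (p z + q z))) \<le> 1"
      unfolding SUP_le_iff using F_le by (auto simp: q_def bidisc_def)
    ultimately show ?L using q by blast
  qed
  show ?thesis
    by (rule iffI, erule necessity, rule sufficiency, erule conjunct2)
qed

end
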